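(* Let $w$ be a nonnegative weight function on $[-1,1]$, let $n$ be a positive integer, and let $\lambda_k$, $x_{k,n}=\cos\theta_{k,n}$ ($1\le k\le n$) be the weights and nodes of the $n$-point Gaussian quadrature rule for $w$. Put $s_{j,k}=\cos\frac{\theta_{j,n}-\theta_{k,n}}{2}$ and $t_{j,k}=\cos\frac{\theta_{j,n}+\theta_{k,n}}{2}$. (i) For the weight function $\mathcal{W}_{-1/2}$ on $[-1,1]^2$, we have the minimal cubature rule of degree $4n-1$ with $\dim\Pi^2_{2n-1}+n$ nodes: for all $f\in\Pi^2_{4n-1}$, $$\int_{[-1,1]^2} f(x,y)\,\mathcal{W}_{-\frac12}(x,y)\,dx\,dy=\frac12\sum_{k=1}^n{\sum_{j=1}^k}'\lambda_k\lambda_j\left[f(s_{j,k},t_{j,k})+f(t_{j,k},s_{j,k})+f(-s_{j,k},-t_{j,k})+f(-t_{j,k},-s_{j,k})\right],$$ where $\sum'$ means that the term with $j=k$ is divided by $2$. (ii) For the weight function $\mathcal{W}_{1/2}$ on $[-1,1]^2$, we have the minimal cubature rule of degree $4n-3$ with $\dim\Pi^2_{2n-3}+n$ nodes: for all $f\in\Pi^2_{4n-3}$, $$\int_{[-1,1]^2} f(x,y)\,\mathcal{W}_{\frac12}(x,y)\,dx\,dy=\frac12\sum_{k=2}^n\sum_{j=1}^{k-1}\lambda_{j,k}\left[f(s_{j,k},t_{j,k})+f(t_{j,k},s_{j,k})+f(-s_{j,k},-t_{j,k})+f(-t_{j,k},-s_{j,k})\right],$$ where $\lambda_{j,k}=\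lambda_j\lambda_k(\cos\theta_{j,n}-\cos\theta_{k,n})^2$.
   Context: $\Pi_m^2$ is the space of real polynomials in two variables of total degree at most $m$; $\dim\Pi_m^2=(m+1)(m+2)/2$. A cubature rule of degree (precision) $s$ for a weight $W$ on a domain is a finite sum $\sum_{i=1}^N\mu_i f(z_i)$ equal to $\int fW$ for all $f\in\Pi_s^2$ and not for all $f\in\Pi_{s+1}^2$. It is minimal if it has the smallest number of nodes among all cubature rules of the same precision for $W$. For centrally symmetric weights every cubature rule of degree $2m-1$ has at least $\dim\Pi_{m-1}^2+\lfloor m/2\rfloor$ nodes, so a rule attaining this bound is minimal. For the weight $w\ge0$ on $[-1,1]$, $c_w$ is the constant with $c_w\int_{-1}^1w(x)\,dx=1$. The Gaussian quadrature rule is $c_w\int_{-1}^1 f(x)w(x)\,dx=\sum_{k=1}^n\lambda_kf(x_{k,n})$ for all univariate polynomials $f$ of degree at most $2n-1$, where $x_{1,n},\dots,x_{n,n}$ are the zeros of the $n$-th orthogonal polynomial with respect to $w$; $0<\theta_{k,n}<\pi$. For $\gamma=\pm\frac12$, $b_{w,\gamma}$ is the constant with $b_{w,\gamma}\int_{-1<x<y<1}w(x)w(y)|x-y|^{2\gamma+1}\,dx\,dy=1$ (so $b_{w,-1/2}=2c_w^2$), and for $(x,y)=(\cos\theta,\cos\phi)\in[-1,1]^2$, $$\mathcal{W}_\gamma(x,y)=b_{w,\gamma}\,4^\gamma\,w(\cos(\theta-\phi))\,w(\cos(\theta+\phi))\,|x^2-y^2|\,(1-x^2)^\gamma(1-y^2)^\gamma,$$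 which has integral $1$ over $[-1,1]^2$.
   Formalization: Part (ii) is false as printed; it is proved for n ≥ 2 with degree 4n−5 instead of 4n−3, dim Π²_{2n−3}+n−1 nodes instead of dim Π²_{2n−3}+n, and the right-hand sum multiplied by b_{w,1/2}/b_{w,−1/2}. Part (i) is as stated. *)

theory Defs
  imports "HOL-Analysis.Analysis" "HOL-Computational_Algebra.Polynomial"
begin

section \<open>Polynomials in two variables and cubature rules\<close>

definition Pi2 :: "nat \<Rightarrow> (real \<times> real \<Rightarrow> real) set" where
  "Pi2 m = {f. \<exists>a :: nat \<Rightarrow> nat \<Rightarrow> real. \<forall>x y.
                 f (x, y) = (\<Sum>i\<le>m. \<Sum>j\<le>m - i. a i j * x ^ i * y ^ j)}"

definition dim_Pi2 :: "nat \<Rightarrow> nat" where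
  "dim_Pi2 m = (m + 1) * (m + 2) div 2"

text \<open>Nodes are distinct points of the plane carrying a nonzero real weight, so that the number of
  nodes is determined by the functional. Nodes need not lie in the domain of integration, and
  weights need not be positive.\<close>

definition cubature_sum :: "nat \<Rightarrow> ((real \<times> real \<Rightarrow> real) \<Rightarrow> real) \<Rightarrow> bool" where
  "cubature_sum N Q \<longleftrightarrow>
     (\<exists>Z \<mu>. finite Z \<and> card Z = N \<and> (\<forall>z\<in>Z. \<mu> z \<noteq> 0) \<and> (\<forall>f. Q f = (\<Sum>z\<in>Z. \<mu> z * f z)))"

definition cubature_exact ::
  "(real \<times> real \<Rightarrow> real) \<Rightarrow> (real \<times> real) set \<Rightarrow> nat \<Rightarrow> ((real \<times> real \<Rightarrow> real) \<Rightarrow> real) \<Rightarrow> bool"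
where
  "cubature_exact W D s Q \<longleftrightarrow>
     (\<forall>f\<in>Pi2 s. set_integrable lebesgue D (\<lambda>z. f z * W z) \<and>
                (LINT z:D|lebesgue. f z * W z) = Q f)"

definition cubature_rule ::
  "(real \<times> real \<Rightarrow> real) \<Rightarrow> (real \<times> real) set \<Rightarrow> nat \<Rightarrow> nat \<Rightarrow>
     ((real \<times> real \<Rightarrow> real) \<Rightarrow> real) \<Rightarrow> bool"
where
  "cubature_rule W D s N Q \<longleftrightarrow>
     cubature_sum N Q \<and> cubature_exact W D s Q \<and> \<not> cubature_exact W D (s + 1) Q"

definition minimal_cubature_rule ::
  "(real \<times> real \<Rightarrow> real) \<Rightarrow> (real \<times> real) set \<Rightarrow> nat \<Rightarrow> nat \<Rightarrow>
     ((real \<times> real \<Rightarrow> real) \<Rightarrow> real) \<Rightarrow> bool"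
where
  "minimal_cubature_rule W D s N Q \<longleftrightarrow>
     cubature_rule W D s N Q \<and> (\<forall>N' Q'. cubature_rule W D s N' Q' \<longrightarrow> N \<le> N')"

section \<open>Weight functions and Gaussian quadrature\<close>

definition weight_function :: "(real \<Rightarrow> real) \<Rightarrow> bool" where
  "weight_function w \<longleftrightarrow>
     (\<forall>x\<in>{-1..1}. 0 \<le> w x) \<and> set_integrable lebesgue {-1..1} w \<and>
     0 < (LINT x:{-1..1}|lebesgue. w x)"

definition c_const :: "(real \<Rightarrow> real) \<Rightarrow> real" where
  "c_const w = 1 / (LINT x:{-1..1}|lebesgue. w x)"

definition orthogonal_poly :: "(real \<Rightarrow> real) \<Rightarrow> nat \<Rightarrow> real poly \<Rightarrow> bool" where
  "orthogonal_poly w n p \<longleftrightarrow>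
     p \<noteq> 0 \<and> degree p = n \<and>
     (\<forall>q. degree q < n \<longrightarrow> (LINT x:{-1..1}|lebesgue. poly p x * poly q x * w x) = 0)"

definition gauss_quadrature ::
  "(real \<Rightarrow> real) \<Rightarrow> nat \<Rightarrow> (nat \<Rightarrow> real) \<Rightarrow> (nat \<Rightarrow> real) \<Rightarrow> bool"
where
  "gauss_quadrature w n lam \<theta> \<longleftrightarrow>
     (\<forall>k\<in>{1..n}. 0 < \<theta> k \<and> \<theta> k < pi) \<and>
     (\<exists>p. orthogonal_poly w n p \<and> bij_betw (\<lambda>k. cos (\<theta> k)) {1..n} {x. poly p x = 0}) \<and>
     (\<forall>f :: real poly. degree f \<le> 2 * n - 1 \<longrightarrow>
        c_const w * (LINT x:{-1..1}|lebesgue. poly f x * w x) =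
          (\<Sum>k=1..n. lam k * poly f (cos (\<theta> k))))"

section \<open>The weight functions on the square\<close>

definition b_const :: "(real \<Rightarrow> real) \<Rightarrow> real \<Rightarrow> real" where
  "b_const w \<gamma> =
     1 / (LINT z:{(x, y). -1 < x \<and> x < y \<and> y < 1}|lebesgue.
            w (fst z) * w (snd z) * \<bar>fst z - snd z\<bar> powr (2 * \<gamma> + 1))"

definition W_square :: "(real \<Rightarrow> real) \<Rightarrow> real \<Rightarrow> real \<times> real \<Rightarrow> real" where
  "W_square w \<gamma> = (\<lambda>(x, y).
     b_const w \<gamma> * 4 powr \<gamma> *
     w (cos (arccos x - arccos y)) * w (cos (arccos x + arccos y)) *
     \<bar>x\<^sup>2 - y\<^sup>2\<bar> * (1 - x\<^sup>2) powr \<gamma> * (1 - y\<^sup>2) powr \<gamma>)"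

definition node_s :: "(nat \<Rightarrow> real) \<Rightarrow> nat \<Rightarrow> nat \<Rightarrow> real" where
  "node_s \<theta> j k = cos ((\<theta> j - \<theta> k) / 2)"

definition node_t :: "(nat \<Rightarrow> real) \<Rightarrow> nat \<Rightarrow> nat \<Rightarrow> real" where
  "node_t \<theta> j k = cos ((\<theta> j + \<theta> k) / 2)"

definition four_sum :: "(real \<times> real \<Rightarrow> real) \<Rightarrow> real \<Rightarrow> real \<Rightarrow> real" where
  "four_sum f s t = f (s, t) + f (t, s) + f (-s, -t) + f (-t, -s)"

definition lambda2 :: "(nat \<Rightarrow> real) \<Rightarrow> (nat \<Rightarrow> real) \<Rightarrow> nat \<Rightarrow> nat \<Rightarrow> real" where
  "lambda2 lam \<theta> j k = lam j * lam k * (cos (\<theta> j) - cos (\<theta> k))\<^sup>2"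

text \<open>The sum \<open>2 * (\<Sum>k=2..n. \<Sum>j=1..k-1. lambda2 lam \<theta> j k)\<close> is twice the variance of the
  normalised weight \<^term>\<open>w\<close>, whereas \<^term>\<open>W_square w (1/2)\<close> has total mass 1. The cubature
  rule for the latter therefore carries the following ratio, which is 1 exactly when the variance
  is 1/2, for instance for the Chebyshev weight of the first kind.

  The nodes of that rule are the \<open>2 * n * (n - 1)\<close> points attached to the pairs \<open>j < k\<close>. This
  number is the lower bound for degree \<open>4 * n - 5\<close>, namely \<open>dim_Pi2 (2 * n - 3) + (n - 1)\<close>, and it is
  below \<open>dim_Pi2 (2 * n - 2)\<close>, so the degree cannot be \<open>4 * n - 4\<close> or larger. The source prints
  degree \<open>4 * n - 3\<close> and \<open>dim_Pi2 (2 * n - 3) + n\<close> nodes, without the ratio, for all \<open>n\<close>.\<close>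

definition norm_ratio :: "(real \<Rightarrow> real) \<Rightarrow> real" where
  "norm_ratio w = b_const w (1/2) / b_const w (-1/2)"

end

theory Submission
  imports Defs
begin

text \<open>
  Write \<open>x = cos \<theta>\<close>, \<open>y = cos \<phi>\<close> and pass to \<open>a = cos (\<theta> + \<phi>)\<close>, \<open>b = cos (\<theta> - \<phi>)\<close>. On each of the
  four triangles into which the diagonals cut the square, this substitution is injective with image
  the triangle \<open>-1 < a < b < 1\<close>. Its Jacobian absorbs the factor \<open>\<bar>x\<^sup>2 - y\<^sup>2\<bar>\<close>, so the weight on the
  square becomes a multiple of \<open>w a * w b * \<bar>a - b\<bar> powr (2 * \<gamma> + 1)\<close>, and the integral of \<open>f\<close>
  becomes the integral of its sum over the orbits of the group generated by the swap of
  coordinates and the central reflection (\<open>W_square_integral\<close>).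

  Such an orbit sum is a symmetric even polynomial in \<open>x\<close> and \<open>y\<close>. Because
  \<open>2 * x * y = a + b\<close> and \<open>x\<^sup>2 + y\<^sup>2 = 1 + a * b\<close>, it is a symmetric polynomial in \<open>a\<close> and \<open>b\<close> of half the degree in
  each variable (\<open>four_sum_bipoly\<close>). By symmetry the integral over the triangle is half the one over
  the square, to which the product of two Gaussian rules applies (\<open>gauss_product_quadrature\<close>).
  For \<open>\<gamma> = -1/2\<close> the power of \<open>\<bar>a - b\<bar>\<close> is \<open>1\<close>; for \<open>\<gamma> = 1/2\<close> it is \<open>(a - b)\<^sup>2\<close>, which costs
  two degrees in each variable and removes the pairs of equal nodes.

  Minimality is a matter of counting. A rule of degree \<open>2 * k + 1\<close>, \<open>k\<close> odd, for a centrally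
  symmetric weight has at least twice as many nodes as there are odd monomials of degree at most \<open>k\<close>
  (\<open>cubature_lower_bound_odd_degree\<close>), and both rules attain this bound. They are not exact in
  the next degree \<open>2 * m\<close>, since that would require as many nodes as there are monomials
  of degree at most \<open>m\<close> (\<open>cubature_lower_bound_even_degree\<close>).
\<close>

section \<open>Change of variables in the plane\<close>

text \<open>On coordinate vectors a derivative has a matrix, and the change of variables formula is governed by
  its determinant. These two maps between such vectors and pairs of reals preserve Lebesgue measure, so
  they carry the formula over to the plane of pairs.\<close>

definition vec2 :: "real \<times> real \<Rightarrow> real^2" where "vec2 z = vector [fst z, snd z]"
definition pair2 :: "real^2 \<Rightarrow> real \<times> real" where "pair2 v = (v $ 1, v $ 2)"

lemma pair2_vec2 [simp]: "pair2 (vec2 z) = z" and vec2_pair2 [simp]: "vec2 (pair2 v) = v"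
  by (simp_all add: vec2_def pair2_def vec_eq_iff forall_2)

lemma linear_vec2: "linear vec2" and linear_pair2: "linear pair2"
  by (auto intro!: linearI simp: vec2_def pair2_def vec_eq_iff forall_2)

lemma borel_measurable_pair2 [measurable]: "pair2 \<in> borel_measurable borel"
  and borel_measurable_vec2 [measurable]: "vec2 \<in> borel_measurable borel"
  by (auto intro!: borel_measurable_continuous_onI linear_continuous_on
      simp: linear_conv_bounded_linear[symmetric] linear_vec2 linear_pair2)

lemma lborel_distr_pair2: "distr lborel borel pair2 = lborel"
proof (rule lborel_eqI[symmetric])
  fix l u :: "real \<times> real"
  assume le: "\<And>b. b \<in> Basis \<Longrightarrow> l \<bullet> b \<le> u \<bullet> b"
  have le': "fst l \<le> fst u" "snd l \<le> snd u"
    using le[of "(1,0)"] le[of "(0,1)"] by (auto simp: Basis_prod_def inner_prod_def)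
  have pre: "pair2 -` box l u = box (vec2 l) (vec2 u)"
    by (auto simp: mem_box_cart forall_2 vec2_def pair2_def mem_box Basis_prod_def inner_prod_def)
  have B2: "(Basis :: (real^2) set) = {axis 1 1, axis 2 1}"
    by (auto simp: Basis_vec_def UNIV_2)
  have ne: "axis (1::2) (1::real) \<noteq> axis 2 1"
    by (simp add: axis_eq_axis)
  have "emeasure (distr lborel borel pair2) (box l u) = emeasure lborel (box (vec2 l) (vec2 u))"
    by (simp add: emeasure_distr pre)
  also have "\<dots> = ennreal ((fst u - fst l) * (snd u - snd l))"
    using le' by (subst emeasure_lborel_box)
      (auto simp: B2 ne inner_axis vec2_def)
  also have "(fst u - fst l) * (snd u - snd l) = (\<Prod>b\<in>Basis. (u - l) \<bullet> b)"
    by (simp add: Basis_prod_def inner_prod_def)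
  finally show "emeasure (distr lborel borel pair2) (box l u) = ennreal (\<Prod>b\<in>Basis. (u - l) \<bullet> b)" .
qed simp

lemma lborel_distr_vec2: "distr lborel borel vec2 = lborel"
proof -
  have "distr (lborel :: (real\<times>real) measure) borel vec2 = distr (distr lborel borel pair2) borel vec2"
    by (simp add: lborel_distr_pair2)
  also have "\<dots> = distr lborel borel (vec2 \<circ> pair2)"
    by (rule distr_distr) auto
  also have "vec2 \<circ> pair2 = id" by (auto simp: o_def)
  finally show ?thesis by (simp add: id_def distr_id2)
qed

text \<open>A Borel map that preserves the measure of Borel sets pulls null sets back to null sets, so it stays
  measurable and measure preserving after completion. Completed measures are unavoidable here:
  a weight function is only Lebesgue measurable.\<close>

lemma measurable_lebesgue_isomorphism:
  fixes h :: "'a::euclidean_space \<Rightarrow> 'b::euclidean_space"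
  assumes "h \<in> borel_measurable borel" "distr lborel borel h = lborel"
  shows "h \<in> lebesgue \<rightarrow>\<^sub>M lebesgue" "distr lebesgue lebesgue h = lebesgue"
proof -
  have h: "h \<in> lebesgue \<rightarrow>\<^sub>M lborel"
    using assms(1) by (simp add: measurable_completion)
  have d: "distr lebesgue lborel h = lborel"
    using assms by (subst distr_completion) (auto cong: distr_cong)
  have c: "complete_measure (lebesgue :: 'a measure)" ..
  show "h \<in> lebesgue \<rightarrow>\<^sub>M lebesgue"
    using h d by (intro complete_measure.measurable_completion2[OF c]) auto
  show "distr lebesgue lebesgue h = lebesgue"
    using complete_measure.completion_distr_eq[OF c h] d by simp
qed

lemma set_integrable_pair2:
  fixes f :: "real \<times> real \<Rightarrow> real"
  shows "set_integrable lebesgue S f \<longleftrightarrow> set_integrable lebesgue (vec2 ` S) (f \<circ> pair2)"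
    and "(LINT z:S|lebesgue. f z) = (LINT v:vec2 ` S|lebesgue. f (pair2 v))"
proof -
  note P = measurable_lebesgue_isomorphism[OF borel_measurable_pair2 lborel_distr_pair2]
  note V = measurable_lebesgue_isomorphism[OF borel_measurable_vec2 lborel_distr_vec2]
  let ?F = "\<lambda>z. indicator S z *\<^sub>R f z" and ?G = "\<lambda>v. indicator (vec2 ` S) v *\<^sub>R f (pair2 v)"
  have G: "?G = (\<lambda>v. ?F (pair2 v))"
    by (auto simp: indicator_def fun_eq_iff image_iff) (metis vec2_pair2)
  have F: "?F = (\<lambda>z. ?G (vec2 z))"
    by (auto simp: indicator_def fun_eq_iff image_iff) (metis pair2_vec2)
  have eq: "integrable lebesgue ?F \<longleftrightarrow> integrable lebesgue ?G"
  proof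
    assume *: "integrable lebesgue ?F"
    then have "integrable (distr lebesgue lebesgue pair2) ?F" by (simp add: P)
    from integrable_distr[OF P(1) this] show "integrable lebesgue ?G" unfolding G .
  next
    assume *: "integrable lebesgue ?G"
    then have "integrable (distr lebesgue lebesgue vec2) ?G" by (simp add: V)
    from integrable_distr[OF V(1) this] show "integrable lebesgue ?F" unfolding F .
  qed
  then show "set_integrable lebesgue S f \<longleftrightarrow> set_integrable lebesgue (vec2 ` S) (f \<circ> pair2)"
    by (simp add: set_integrable_def o_def)
  show "(LINT z:S|lebesgue. f z) = (LINT v:vec2 ` S|lebesgue. f (pair2 v))"
  proof (cases "integrable lebesgue ?F")
    case True
    have "integral\<^sup>L lebesgue ?F = integral\<^sup>L (distr lebesgue lebesgue pair2) ?F" by (simp add: P)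
    also have "\<dots> = integral\<^sup>L lebesgue ?G"
      unfolding G by (rule integral_distr[OF P(1)]) (use True in auto)
    finally show ?thesis by (simp add: set_lebesgue_integral_def)
  next
    case False
    with eq show ?thesis by (simp add: set_lebesgue_integral_def not_integrable_integral_eq)
  qed
qed

lemma change_of_variables_plane:
  fixes f :: "real \<times> real \<Rightarrow> real" and g :: "real \<times> real \<Rightarrow> real \<times> real"
    and g' :: "real \<times> real \<Rightarrow> real \<times> real \<Rightarrow> real \<times> real"
  assumes S: "S \<in> sets lebesgue"
    and der: "\<And>z. z \<in> S \<Longrightarrow> (g has_derivative g' z) (at z within S)"
    and inj: "inj_on g S"
    and J: "\<And>z. z \<in> S \<Longrightarrow>
      J z = \<bar>fst (g' z (1,0)) * snd (g' z (0,1)) - fst (g' z (0,1)) * snd (g' z (1,0))\<bar>"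
  shows "set_integrable lebesgue S (\<lambda>z. J z * f (g z)) \<longleftrightarrow> set_integrable lebesgue (g ` S) f"
    and "set_integrable lebesgue (g ` S) f \<Longrightarrow>
      (LINT z:S|lebesgue. J z * f (g z)) = (LINT z:g ` S|lebesgue. f z)"
proof -
  let ?S = "vec2 ` S" and ?g = "vec2 \<circ> g \<circ> pair2" and ?g' = "\<lambda>v. vec2 \<circ> g' (pair2 v) \<circ> pair2"
  let ?f = "\<lambda>v. (\<chi> i. f (pair2 v)) :: real^1"
  have im: "?g ` ?S = vec2 ` g ` S" by (auto simp: image_image)
  have pv: "pair2 -` S = vec2 ` S"
    by (auto simp: image_iff) (metis vec2_pair2)
  have S': "?S \<in> sets lebesgue"
    using measurable_sets[OF measurable_lebesgue_isomorphism(1)[OF borel_measurable_pair2 lborel_distr_pair2] S]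
    by (simp add: pv)
  have lin: "linear (g' z)" if "z \<in> S" for z
    using der[OF that] by (rule has_derivative_linear)
  have der': "(?g has_derivative ?g' v) (at v within ?S)" if "v \<in> ?S" for v
  proof -
    have z: "pair2 v \<in> S" using that by auto
    have "pair2 ` ?S = S" by (auto simp: image_image)
    with der[OF z] have "(g has_derivative g' (pair2 v)) (at (pair2 v) within pair2 ` ?S)" by simp
    moreover have "(pair2 has_derivative pair2) (at v within ?S)"
      using linear_pair2 by (simp add: linear_imp_has_derivative)
    ultimately have "(g \<circ> pair2 has_derivative g' (pair2 v) \<circ> pair2) (at v within ?S)"
      by (rule diff_chain_within[rotated])
    moreover have "(vec2 has_derivative vec2) (at ((g \<circ> pair2) v) within (g \<circ> pair2) ` ?S)"
      using linear_vec2 by (simp add: linear_imp_has_derivative)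
    ultimately have "(vec2 \<circ> (g \<circ> pair2) has_derivative vec2 \<circ> (g' (pair2 v) \<circ> pair2)) (at v within ?S)"
      by (rule diff_chain_within)
    then show ?thesis by (simp add: o_assoc)
  qed
  have inj': "inj_on ?g ?S"
  proof (rule inj_onI)
    fix a b assume a: "a \<in> ?S" "b \<in> ?S" "?g a = ?g b"
    then have "g (pair2 a) = g (pair2 b)" by (metis comp_apply pair2_vec2)
    with a inj have "pair2 a = pair2 b" by (auto dest: inj_onD)
    then show "a = b" by (metis vec2_pair2)
  qed
  have det: "\<bar>det (matrix (?g' v))\<bar> = J (pair2 v)" if v: "v \<in> ?S" for v
  proof -
    obtain z where z: "z \<in> S" "v = vec2 z" using v by blast
    have "pair2 (axis 1 1) = (1,0)" "pair2 (axis 2 1) = (0,1)"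
      by (auto simp: pair2_def axis_def)
    then show ?thesis
      using J[OF z(1)] by (simp add: z(2)) (simp add: det_2 matrix_def vec2_def)
  qed
  note CV = has_absolute_integral_change_of_variables[OF S' der' inj', of ?f]
  have c1: "(\<lambda>v. \<bar>det (matrix (?g' v))\<bar> *\<^sub>R ?f (?g v)) absolutely_integrable_on ?S \<longleftrightarrow>
      (\<lambda>v. J (pair2 v) * f (g (pair2 v))) absolutely_integrable_on ?S"
    unfolding absolutely_integrable_on_1_iff
    by (intro set_integrable_cong) (auto simp: det)
  have c2: "?f absolutely_integrable_on ?g ` ?S \<longleftrightarrow> (f \<circ> pair2) absolutely_integrable_on vec2 ` g ` S"
    unfolding absolutely_integrable_on_1_iff im by (simp add: o_def)
  have "(\<lambda>v. \<bar>det (matrix (?g' v))\<bar> *\<^sub>R ?f (?g v)) absolutely_integrable_on ?S \<longleftrightarrow>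
     ?f absolutely_integrable_on ?g ` ?S"
    using CV by blast
  then show iff: "set_integrable lebesgue S (\<lambda>z. J z * f (g z)) \<longleftrightarrow> set_integrable lebesgue (g ` S) f"
    unfolding c1 c2 set_integrable_pair2(1)[of "g ` S"] set_integrable_pair2(1)[of S] by (simp add: o_def)
  assume int: "set_integrable lebesgue (g ` S) f"
  then have i2: "?f absolutely_integrable_on ?g ` ?S" using c2 set_integrable_pair2(1) by blast
  with CV[of "integral (?g ` ?S) ?f"]
  have i1: "(\<lambda>v. \<bar>det (matrix (?g' v))\<bar> *\<^sub>R ?f (?g v)) absolutely_integrable_on ?S"
    and e: "integral ?S (\<lambda>v. \<bar>det (matrix (?g' v))\<bar> *\<^sub>R ?f (?g v)) = integral (?g ` ?S) ?f"
    by auto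
  have "(LINT z:S|lebesgue. J z * f (g z)) = (LINT v:?S|lebesgue. J (pair2 v) * f (g (pair2 v)))"
    by (rule set_integrable_pair2(2))
  also have "\<dots> = integral ?S (\<lambda>v. J (pair2 v) * f (g (pair2 v)))"
    using i1 c1 by (intro set_lebesgue_integral_eq_integral(2)) auto
  also have "\<dots> = integral ?S (\<lambda>v. (\<bar>det (matrix (?g' v))\<bar> *\<^sub>R ?f (?g v)) $ 1)"
    by (intro integral_cong) (auto simp: det)
  also have "\<dots> = integral ?S (\<lambda>v. \<bar>det (matrix (?g' v))\<bar> *\<^sub>R ?f (?g v)) $ 1"
    using i1 by (subst integral_component_eq_cart) (auto intro: set_lebesgue_integral_eq_integral(1))
  also have "\<dots> = integral (vec2 ` g ` S) ?f $ 1" unfolding e im ..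
  also have "\<dots> = integral (vec2 ` g ` S) (\<lambda>v. f (pair2 v))"
    using i2 unfolding im by (subst integral_component_eq_cart[symmetric]) (auto intro: set_lebesgue_integral_eq_integral(1))
  also have "\<dots> = (LINT v:vec2 ` g ` S|lebesgue. f (pair2 v))"
    using i2 c2 by (intro set_lebesgue_integral_eq_integral(2)[symmetric]) (auto simp: o_def)
  also have "\<dots> = (LINT z:g ` S|lebesgue. f z)"
    by (rule set_integrable_pair2(2)[symmetric])
  finally show "(LINT z:S|lebesgue. J z * f (g z)) = (LINT z:g ` S|lebesgue. f z)" .
qed

section \<open>Lebesgue integrals of products\<close>

lemma absolutely_integrable_continuous_mult:
  fixes f g :: "'a::euclidean_space \<Rightarrow> real"
  assumes "compact S" "continuous_on S f" "g absolutely_integrable_on S"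
  shows "(\<lambda>z. f z * g z) absolutely_integrable_on S"
proof -
  have S: "S \<in> sets lebesgue" using assms(1) by (simp add: lmeasurable_compact fmeasurableD)
  show ?thesis
    using assms S by (intro absolutely_integrable_bounded_measurable_product[OF bilinear_times _ S]
      continuous_imp_measurable_on_sets_lebesgue compact_imp_bounded compact_continuous_image)
qed

lemma set_lebesgue_integral_spike_set:
  fixes f :: "'a::euclidean_space \<Rightarrow> real"
  assumes f: "set_integrable lebesgue S f" and N: "negligible (S - T)" "negligible (T - S)"
  shows "set_integrable lebesgue T f" "(LINT z:S|lebesgue. f z) = (LINT z:T|lebesgue. f z)"
proof -
  show T: "set_integrable lebesgue T f"
    using f by (rule absolutely_integrable_spike_set) (auto intro: negligible_subset[OF N(1)] negligible_subset[OF N(2)])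
  have "integral S f = integral T f"
    by (rule integral_spike_set) (auto intro: negligible_subset[OF N(1)] negligible_subset[OF N(2)])
  with f T show "(LINT z:S|lebesgue. f z) = (LINT z:T|lebesgue. f z)"
    by (simp add: set_lebesgue_integral_eq_integral(2))
qed

lemma null_set_Times_lborel:
  assumes "N \<in> null_sets (lborel :: real measure)"
  shows "N \<times> UNIV \<in> null_sets (lborel :: (real \<times> real) measure)"
    "UNIV \<times> N \<in> null_sets (lborel :: (real \<times> real) measure)"
  using assms
  by (auto simp: null_sets_def lborel_prod[symmetric] lborel.emeasure_pair_measure_Times)

lemma measurable_fst_snd_lebesgue:
  "fst \<in> (lebesgue :: (real \<times> real) measure) \<rightarrow>\<^sub>M lebesgue"
  "snd \<in> (lebesgue :: (real \<times> real) measure) \<rightarrow>\<^sub>M lebesgue"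
proof -
  have c: "complete_measure (lebesgue :: (real \<times> real) measure)" ..
  have m: "fst \<in> (lebesgue :: (real \<times> real) measure) \<rightarrow>\<^sub>M lborel" "snd \<in> (lebesgue :: (real \<times> real) measure) \<rightarrow>\<^sub>M lborel"
    by (auto intro!: measurable_completion simp: borel_prod[symmetric])
  have *: "N \<times> UNIV \<in> null_sets (lebesgue :: (real \<times> real) measure)" "UNIV \<times> N \<in> null_sets (lebesgue :: (real \<times> real) measure)"
    "N \<in> sets borel" if "N \<in> null_sets (lborel :: real measure)" for N
    using null_set_Times_lborel[OF that] null_setsD2[OF that] by (auto intro: null_sets_completionI)
  have pre: "fst -` N = N \<times> (UNIV :: real set)" "snd -` N = (UNIV :: real set) \<times> N" for N :: "real set"
    by auto
  show "fst \<in> (lebesgue :: (real \<times> real) measure) \<rightarrow>\<^sub>M lebesgue"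
    using m(1) by (rule complete_measure.measurable_completion2[OF c])
      (use * m in \<open>auto simp: null_sets_distr_iff pre \<close>)
  show "snd \<in> (lebesgue :: (real \<times> real) measure) \<rightarrow>\<^sub>M lebesgue"
    using m(2) by (rule complete_measure.measurable_completion2[OF c])
      (use * m in \<open>auto simp: null_sets_distr_iff pre \<close>)
qed

lemma lebesgue_integral_product:
  fixes f g :: "real \<Rightarrow> real"
  assumes f: "integrable lebesgue f" and g: "integrable lebesgue g"
  shows "integrable lebesgue (\<lambda>z. f (fst z) * g (snd z))"
    and "(LINT z|lebesgue. f (fst z) * g (snd z)) = integral\<^sup>L lebesgue f * integral\<^sup>L lebesgue g"
proof -
  obtain f' where f'[measurable]: "f' \<in> borel_measurable lborel" and ff: "AE x in lborel. f x = f' x"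
    using completion_ex_borel_measurable_real[of f lborel] f by auto
  obtain g' where g'[measurable]: "g' \<in> borel_measurable lborel" and gg: "AE x in lborel. g x = g' x"
    using completion_ex_borel_measurable_real[of g lborel] g by auto
  have ml: "f' \<in> borel_measurable lebesgue" "g' \<in> borel_measurable lebesgue"
    using f' g' by (auto intro: measurable_completion)
  have "integrable lebesgue f'" "integrable lebesgue g'"
    using integrable_cong_AE_imp[OF f ml(1)] integrable_cong_AE_imp[OF g ml(2)]
      AE_completion[OF ff] AE_completion[OF gg] by auto
  then have i: "integrable lborel f'" "integrable lborel g'" by (simp_all add: integrable_completion)
  have eq: "integral\<^sup>L lebesgue f = integral\<^sup>L lborel f'" "integral\<^sup>L lebesgue g = integral\<^sup>L lborel g'"
    using integral_completion[OF f'] integral_completion[OF g'] integral_cong_AE[OF borel_measurable_integrable[OF f] ml(1) AE_completion[OF ff]]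
      integral_cong_AE[OF borel_measurable_integrable[OF g] ml(2) AE_completion[OF gg]] by auto
  have I: "integrable (lborel \<Otimes>\<^sub>M lborel) (\<lambda>z. f' (fst z) * g' (snd z))"
    by (rule lborel_pair.Fubini_integrable)
      (use i in \<open>auto simp: abs_mult intro!: integrable_mult_left integrable_mult_right\<close>)
  have E: "integral\<^sup>L (lborel \<Otimes>\<^sub>M lborel) (\<lambda>z. f' (fst z) * g' (snd z)) = integral\<^sup>L lborel f' * integral\<^sup>L lborel g'"
    using lborel_pair.integral_fst'[OF I] by simp
  have m: "(\<lambda>z. f' (fst z) * g' (snd z)) \<in> borel_measurable lborel"
    using I by (simp add: lborel_prod[symmetric])
  obtain N where N: "N \<in> null_sets lborel" "{x. f x \<noteq> f' x} \<subseteq> N"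
    using ff by (auto elim!: AE_E simp: null_sets_def)
  obtain M where M: "M \<in> null_sets lborel" "{x. g x \<noteq> g' x} \<subseteq> M"
    using gg by (auto elim!: AE_E simp: null_sets_def)
  have ae: "AE z in lebesgue. f' (fst z) * g' (snd z) = f (fst z) * g (snd z)"
  proof (rule AE_completion, rule AE_I')
    show "N \<times> UNIV \<union> UNIV \<times> M \<in> null_sets (lborel :: (real \<times> real) measure)"
      using N M null_set_Times_lborel by auto
    show "{z \<in> space lborel. f' (fst z) * g' (snd z) \<noteq> f (fst z) * g (snd z)} \<subseteq> N \<times> UNIV \<union> UNIV \<times> M"
    proof
      fix z assume "z \<in> {z \<in> space lborel. f' (fst z) * g' (snd z) \<noteq> f (fst z) * g (snd z)}"
      then have "f (fst z) \<noteq> f' (fst z) \<or> g (snd z) \<noteq> g' (snd z)" by auto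
      then show "z \<in> N \<times> UNIV \<union> UNIV \<times> M" using N(2) M(2) by (cases z) auto
    qed
  qed
  have m2: "(\<lambda>z. f (fst z) * g (snd z)) \<in> borel_measurable lebesgue"
    using measurable_compose[OF measurable_fst_snd_lebesgue(1) borel_measurable_integrable[OF f]]
      measurable_compose[OF measurable_fst_snd_lebesgue(2) borel_measurable_integrable[OF g]]
    by (rule borel_measurable_times)
  have I': "integrable lebesgue (\<lambda>z. f' (fst z) * g' (snd z))"
    using I m by (simp add: integrable_completion lborel_prod)
  show "integrable lebesgue (\<lambda>z. f (fst z) * g (snd z))"
    by (rule integrable_cong_AE_imp[OF I' m2 ]) (use ae in auto)
  show "(LINT z|lebesgue. f (fst z) * g (snd z)) = integral\<^sup>L lebesgue f * integral\<^sup>L lebesgue g"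
    using integral_cong_AE[OF borel_measurable_integrable[OF I'] m2 ae] E eq integral_completion[OF m]
    by (simp add: lborel_prod)
qed

text \<open>The coordinate projections pull null sets back to null sets, so that Fubini for Borel
  representatives of the two factors carries over to Lebesgue measurable factors.\<close>

lemma set_lebesgue_integral_product:
  fixes f g :: "real \<Rightarrow> real"
  assumes f: "set_integrable lebesgue A f" and g: "set_integrable lebesgue B g"
  shows "set_integrable lebesgue (A \<times> B) (\<lambda>z. f (fst z) * g (snd z))"
    and "(LINT z:A \<times> B|lebesgue. f (fst z) * g (snd z)) = (LINT x:A|lebesgue. f x) * (LINT x:B|lebesgue. g x)"
proof -
  have "(\<lambda>z. indicator (A \<times> B) z *\<^sub>R (f (fst z) * g (snd z))) =
      (\<lambda>z. (indicator A (fst z) *\<^sub>R f (fst z)) * (indicator B (snd z) *\<^sub>R g (snd z)))"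
    by (auto simp: fun_eq_iff indicator_def)
  with lebesgue_integral_product[OF f[unfolded set_integrable_def] g[unfolded set_integrable_def]]
  show "set_integrable lebesgue (A \<times> B) (\<lambda>z. f (fst z) * g (snd z))"
    and "(LINT z:A \<times> B|lebesgue. f (fst z) * g (snd z)) = (LINT x:A|lebesgue. f x) * (LINT x:B|lebesgue. g x)"
    by (simp_all only: set_integrable_def set_lebesgue_integral_def)
qed

section \<open>The square and the triangle above its diagonal\<close>

abbreviation square :: "(real \<times> real) set" where "square \<equiv> {-1..1} \<times> {-1..1}"

definition open_triangle :: "(real \<times> real) set" where
  "open_triangle = {(x, y). -1 < x \<and> x < y \<and> y < 1}"

lemma negligible_line: "(a::real, b::real) \<noteq> 0 \<Longrightarrow> negligible {(x::real, y::real). a * x + b * y = c}"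
  using negligible_hyperplane[of "(a,b)" c] by (simp add: inner_prod_def case_prod_beta' mult.commute)

lemma open_triangle_lebesgue [simp]: "open_triangle \<in> sets lebesgue"
proof -
  have "{z::real\<times>real. -1 < fst z \<and> fst z < snd z \<and> snd z < 1} \<in> sets borel"
    by (intro borel_open open_Collect_conj open_Collect_less continuous_intros)
  then show ?thesis by (simp add: open_triangle_def case_prod_beta' sets_completionI_sets)
qed

text \<open>Reflection in the diagonal exchanges the two open triangles that make up the square up to a null set.\<close>

lemma triangle_symmetric_integral:
  fixes h :: "real \<times> real \<Rightarrow> real"
  assumes int: "set_integrable lebesgue square h"
    and sym: "\<And>x y. x \<in> {-1..1} \<Longrightarrow> y \<in> {-1..1} \<Longrightarrow> h (y, x) = h (x, y)"
  shows "(LINT z:open_triangle|lebesgue. h z) = (LINT z:square|lebesgue. h z) / 2"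
proof -
  let ?T = "prod.swap ` open_triangle"
  have sub: "open_triangle \<subseteq> square" by (auto simp: open_triangle_def)
  have i1: "set_integrable lebesgue open_triangle h"
    by (rule set_integrable_subset[OF int _ sub]) simp
  have d: "(prod.swap has_derivative prod.swap) F" for F :: "(real \<times> real) filter"
    by (intro linear_imp_has_derivative linearI) auto
  note CV = change_of_variables_plane[OF open_triangle_lebesgue d inj_on_subset[OF inj_swap subset_UNIV], where J="\<lambda>_. 1"]
  have "set_integrable lebesgue open_triangle (\<lambda>z. h (prod.swap z)) = set_integrable lebesgue open_triangle h"
    using sub by (intro set_integrable_cong) (auto simp: sym)
  with CV(1)[of h] i1 have i2: "set_integrable lebesgue ?T h" by simp
  have e: "(LINT z:?T|lebesgue. h z) = (LINT z:open_triangle|lebesgue. h (prod.swap z))"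
    using CV(2)[OF _ i2] by simp
  also have "\<dots> = (LINT z:open_triangle|lebesgue. h z)"
    using sub by (intro set_lebesgue_integral_cong) (auto simp: sym)
  finally have e: "(LINT z:?T|lebesgue. h z) = (LINT z:open_triangle|lebesgue. h z)" .
  have "negligible ({(x,y). 1 * x + 0 * y = -1} \<union> {(x,y). 0 * x + 1 * y = -1} \<union> {(x,y). 1 * x + 0 * y = (1::real)}
    \<union> {(x,y). 0 * x + 1 * y = (1::real)} \<union> {(x,y). 1 * x + (-1) * y = (0::real)})"
    by (intro negligible_Un negligible_line) (auto simp: zero_prod_def)
  then have N: "negligible (square - (open_triangle \<union> ?T))"
    by (rule negligible_subset) (auto simp: open_triangle_def image_iff)
  have "(LINT z:square|lebesgue. h z) = (LINT z:open_triangle \<union> ?T|lebesgue. h z)"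
    using sub by (intro set_lebesgue_integral_spike_set(2)[OF int N]) (auto intro!: negligible_subset[OF negligible_empty])
  also have "\<dots> = (LINT z:open_triangle|lebesgue. h z) + (LINT z:?T|lebesgue. h z)"
    using i1 i2 by (intro set_integral_Un) (auto simp: open_triangle_def)
  finally show ?thesis using e by simp
qed

section \<open>Cosines of sums and differences of angles\<close>

text \<open>Of the four open triangles cut out of the square by its diagonals, the right-hand one. With
  \<open>x = cos \<theta>\<close> and \<open>y = cos \<phi>\<close> it is the region \<open>\<theta> < \<phi>\<close>, \<open>\<theta> + \<phi> < \<pi>\<close>, on which
  \<open>(\<theta>, \<phi>)\<close> can be recovered from the cosines of sum and difference.\<close>

definition sector :: "(real \<times> real) set" where
  "sector = {(x, y). \<bar>y\<bar> < x \<and> x < 1}"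

text \<open>The map \<open>(cos \<theta>, cos \<phi>) \<mapsto> (cos (\<theta> + \<phi>), cos (\<theta> - \<phi>))\<close> for \<open>\<theta>, \<phi>\<close> in \<open>[0, \<pi>]\<close>, written without
  trigonometry so that it can be differentiated directly.\<close>

definition angle_sums :: "real \<times> real \<Rightarrow> real \<times> real" where
  "angle_sums = (\<lambda>(x, y). (x * y - sqrt (1 - x\<^sup>2) * sqrt (1 - y\<^sup>2), x * y + sqrt (1 - x\<^sup>2) * sqrt (1 - y\<^sup>2)))"

text \<open>The inverse map \<open>(cos \<alpha>, cos \<beta>) \<mapsto> (cos ((\<alpha> - \<beta>) / 2), cos ((\<alpha> + \<beta>) / 2))\<close>: the two square roots are
  twice the products of the cosines and of the sines of \<open>\<alpha> / 2\<close> and \<open>\<beta> / 2\<close>. It is symmetric in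
  its two arguments, and it sends pairs of Gaussian nodes to nodes of the cubature rule.\<close>

definition half_angles :: "real \<times> real \<Rightarrow> real \<times> real" where
  "half_angles = (\<lambda>(a, b). ((sqrt ((1 + a) * (1 + b)) + sqrt ((1 - a) * (1 - b))) / 2,
                          (sqrt ((1 + a) * (1 + b)) - sqrt ((1 - a) * (1 - b))) / 2))"

lemma open_sector: "open sector"
proof -
  have "open {z::real\<times>real. \<bar>snd z\<bar> < fst z \<and> fst z < 1}"
    by (intro open_Collect_conj open_Collect_less continuous_intros)
  then show ?thesis by (simp add: sector_def case_prod_beta')
qed

lemma sector_lebesgue [simp]: "sector \<in> sets lebesgue"
  using open_sector by (simp add: borel_open sets_completionI_sets)

lemma sectorD:
  assumes "(x, y) \<in> sector"
  shows "0 < x" "x < 1" "\<bar>y\<bar> < x" "x\<^sup>2 < 1" "y\<^sup>2 < 1" "y\<^sup>2 < x\<^sup>2"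
proof -
  show "0 < x" "x < 1" "\<bar>y\<bar> < x" using assms by (auto simp: sector_def)
  then show "x\<^sup>2 < 1" "y\<^sup>2 < 1" "y\<^sup>2 < x\<^sup>2"
    using abs_square_less_1[of x] abs_square_less_1[of y] power_strict_mono[of "\<bar>y\<bar>" x 2] by auto
qed

lemma half_angles_angle_sums:
  assumes "z \<in> sector" shows "half_angles (angle_sums z) = z"
proof (cases z)
  case (Pair x y)
  note s = sectorD[OF assms[unfolded Pair]]
  define r where "r = sqrt (1 - x\<^sup>2) * sqrt (1 - y\<^sup>2)"
  have r2: "r * r = (1 - x\<^sup>2) * (1 - y\<^sup>2)"
    using s by (simp add: r_def real_sqrt_mult[symmetric])
  have "(1 + (x * y - r)) * (1 + (x * y + r)) = (1 + x * y)\<^sup>2 - r * r"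
    "(1 - (x * y - r)) * (1 - (x * y + r)) = (1 - x * y)\<^sup>2 - r * r"
    by (simp_all add: algebra_simps power2_eq_square)
  then have "(1 + (x * y - r)) * (1 + (x * y + r)) = (x + y)\<^sup>2"
    "(1 - (x * y - r)) * (1 - (x * y + r)) = (x - y)\<^sup>2"
    unfolding r2 by (simp_all add: algebra_simps power2_eq_square)
  then show ?thesis
    using s by (simp add: Pair angle_sums_def half_angles_def r_def[symmetric])
qed

text \<open>These two identities turn symmetric even polynomials in \<open>(x, y)\<close> into symmetric polynomials in
  \<open>(a, b)\<close> of half the degree. They also determine the unordered pair \<open>{a, b}\<close> from \<open>(x, y)\<close>.\<close>

lemma half_angles_identities:
  assumes "half_angles (a, b) = (x, y)" "a \<in> {-1..1}" "b \<in> {-1..1}"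
  shows "2 * (x * y) = a + b" "x\<^sup>2 + y\<^sup>2 = 1 + a * b"
proof -
  define p q where "p = sqrt ((1 + a) * (1 + b))" and "q = sqrt ((1 - a) * (1 - b))"
  have *: "p\<^sup>2 = (1 + a) * (1 + b)" "q\<^sup>2 = (1 - a) * (1 - b)"
    using assms by (simp_all add: p_def q_def)
  have xy: "x = (p + q) / 2" "y = (p - q) / 2"
    using assms by (auto simp: half_angles_def p_def q_def)
  have "2 * (x * y) = (p\<^sup>2 - q\<^sup>2) / 2" "x\<^sup>2 + y\<^sup>2 = (p\<^sup>2 + q\<^sup>2) / 2"
    unfolding xy by (simp_all add: field_simps power2_eq_square)
  then show "2 * (x * y) = a + b" "x\<^sup>2 + y\<^sup>2 = 1 + a * b"
    unfolding * by (simp_all add: field_simps)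
qed

lemma angle_sums_sector: "angle_sums ` sector = open_triangle"
proof (intro subset_antisym subsetI)
  fix z assume "z \<in> angle_sums ` sector"
  then obtain x y where xy: "(x, y) \<in> sector" and z: "z = angle_sums (x, y)" by auto
  note s = sectorD[OF xy]
  define r where "r = sqrt (1 - x\<^sup>2) * sqrt (1 - y\<^sup>2)"
  have r2: "r\<^sup>2 = (1 - x\<^sup>2) * (1 - y\<^sup>2)" and r0: "r > 0"
    using s by (simp_all add: r_def power_mult_distrib)
  have xy1: "\<bar>x * y\<bar> < 1"
    using s mult_strict_mono[of "\<bar>x\<bar>" 1 "\<bar>y\<bar>" 1] by (simp add: abs_mult)
  have "(1 - x * y)\<^sup>2 - r\<^sup>2 = (x - y)\<^sup>2" "(1 + x * y)\<^sup>2 - r\<^sup>2 = (x + y)\<^sup>2"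
    unfolding r2 by (simp_all add: algebra_simps power2_eq_square)
  moreover have "(x - y)\<^sup>2 > 0" "(x + y)\<^sup>2 > 0" using s by auto
  ultimately have "r\<^sup>2 < (1 - x * y)\<^sup>2" "r\<^sup>2 < (1 + x * y)\<^sup>2" by linarith+
  then have "r < 1 - x * y" "r < 1 + x * y"
    using xy1 by (auto intro: power2_less_imp_less)
  then show "z \<in> open_triangle"
    using r0 by (simp add: z angle_sums_def open_triangle_def r_def[symmetric])
next
  fix z assume "z \<in> open_triangle"
  then obtain a b where z: "z = (a, b)" and ab: "-1 < a" "a < b" "b < 1"
    by (auto simp: open_triangle_def)
  obtain x y where xy: "half_angles (a, b) = (x, y)" by fastforce
  define p q where "p = sqrt ((1 + a) * (1 + b))" and "q = sqrt ((1 - a) * (1 - b))"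
  have *: "p\<^sup>2 = (1 + a) * (1 + b)" "q\<^sup>2 = (1 - a) * (1 - b)" "p > 0" "q > 0"
    using ab by (simp_all add: p_def q_def)
  have xy': "x = (p + q) / 2" "y = (p - q) / 2"
    using xy by (auto simp: half_angles_def p_def q_def)
  have "((2 + a + b) / 2)\<^sup>2 - p\<^sup>2 = ((b - a) / 2)\<^sup>2" "((2 - a - b) / 2)\<^sup>2 - q\<^sup>2 = ((b - a) / 2)\<^sup>2"
    unfolding * by (simp_all add: field_simps power2_eq_square)
  moreover have "((b - a) / 2)\<^sup>2 > 0" using ab by simp
  ultimately have "p\<^sup>2 < ((2 + a + b) / 2)\<^sup>2" "q\<^sup>2 < ((2 - a - b) / 2)\<^sup>2" by linarith+
  note power2_less_imp_less[OF this(1)] power2_less_imp_less[OF this(2)]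
  then have "p < (2 + a + b) / 2" "q < (2 - a - b) / 2" using ab by auto
  then have sec: "(x, y) \<in> sector"
    using * xy' by (auto simp: sector_def)
  note s = sectorD[OF sec]
  have id: "x * y = (a + b) / 2" "x\<^sup>2 + y\<^sup>2 = 1 + a * b"
    using half_angles_identities[OF xy] ab by auto
  have "(1 - x\<^sup>2) * (1 - y\<^sup>2) = 1 - (x\<^sup>2 + y\<^sup>2) + (x * y)\<^sup>2"
    by (simp add: algebra_simps power2_eq_square)
  also have "\<dots> = ((b - a) / 2)\<^sup>2"
    unfolding id by (simp add: field_simps power2_eq_square)
  finally have "sqrt (1 - x\<^sup>2) * sqrt (1 - y\<^sup>2) = (b - a) / 2"
    using ab by (simp add: real_sqrt_mult[symmetric])
  then have "angle_sums (x, y) = z"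
    by (simp add: angle_sums_def z id field_simps)
  with sec show "z \<in> angle_sums ` sector" by blast
qed

text \<open>The swap of coordinates and the central reflection generate a group of four symmetries, indexed by
  two Booleans. They permute the four open triangles, leave the weight invariant, and \<^const>\<open>four_sum\<close>
  is the sum over one orbit.\<close>

definition sym4 :: "bool \<times> bool \<Rightarrow> real \<times> real \<Rightarrow> real \<times> real" where
  "sym4 = (\<lambda>(p, q) (x, y). let (s, t) = (if p then (y, x) else (x, y)) in if q then (-s, -t) else (s, t))"

lemma sym4_simps [simp]:
  "sym4 (False, False) (x, y) = (x, y)" "sym4 (True, False) (x, y) = (y, x)"
  "sym4 (False, True) (x, y) = (-x, -y)" "sym4 (True, True) (x, y) = (-y, -x)"
  by (simp_all add: sym4_def)

lemma UNIV_sym4: "(UNIV :: (bool \<times> bool) set) = {(False, False), (True, False), (False, True), (True, True)}"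
  by auto

lemma four_sum_sym4: "four_sum f x y = (\<Sum>e\<in>UNIV. f (sym4 e (x, y)))"
  by (simp add: four_sum_def UNIV_sym4)

lemma sym4_cases:
  obtains "sym4 e = (\<lambda>(x, y). (x, y))" | "sym4 e = (\<lambda>(x, y). (y, x))"
    | "sym4 e = (\<lambda>(x, y). (-x, -y))" | "sym4 e = (\<lambda>(x, y). (-y, -x))"
proof -
  obtain p q where e: "e = (p, q)" by (cases e)
  show thesis
    by (cases p; cases q) (use that e in \<open>simp_all add: sym4_def\<close>)
qed

lemma sym4_cone_inject:
  assumes "\<bar>y\<bar> < x" "\<bar>y'\<bar> < x'" "sym4 e (x, y) = sym4 e' (x', y')"
  shows "e = e' \<and> x = x' \<and> y = y'"
  using assms by (cases e; cases e') (auto simp: sym4_def Let_def split: if_splits)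

text \<open>The weight which, up to the constant \<open>b_const w \<gamma> / 4\<close>, the substitution \<open>angle_sums\<close>
  makes out of \<open>W_square w \<gamma>\<close>.\<close>

definition angle_weight :: "(real \<Rightarrow> real) \<Rightarrow> real \<Rightarrow> real \<times> real \<Rightarrow> real" where
  "angle_weight w \<gamma> = (\<lambda>(a, b). w a * w b * \<bar>a - b\<bar> powr (2 * \<gamma> + 1))"

lemma W_square_swap: "W_square w \<gamma> (y, x) = W_square w \<gamma> (x, y)"
proof -
  have "cos (arccos y - arccos x) = cos (arccos x - arccos y)"
    by (metis cos_minus minus_diff_eq)
  moreover have "\<bar>y\<^sup>2 - x\<^sup>2\<bar> = \<bar>x\<^sup>2 - y\<^sup>2\<bar>" "arccos y + arccos x = arccos x + arccos y"
    by simp_all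
  ultimately show ?thesis unfolding W_square_def prod.case by (simp only: mult_ac)
qed

lemma W_square_minus:
  assumes "(x, y) \<in> square" shows "W_square w \<gamma> (-x, -y) = W_square w \<gamma> (x, y)"
proof -
  have "arccos (-x) = pi - arccos x" "arccos (-y) = pi - arccos y"
    using assms by (auto intro: arccos_minus)
  moreover have "cos ((pi - s) - (pi - t)) = cos (s - t)" "cos ((pi - s) + (pi - t)) = cos (s + t)" for s t
    by (simp_all add: cos_diff cos_add)
  ultimately show ?thesis by (simp add: W_square_def)
qed

lemma W_square_sym4:
  assumes "(x, y) \<in> square" shows "W_square w \<gamma> (sym4 e (x, y)) = W_square w \<gamma> (x, y)"
  using W_square_minus[OF assms] W_square_swap[of w \<gamma> x y] W_square_swap[of w \<gamma> "-x" "-y"]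
  by (cases e rule: sym4_cases) simp_all

text \<open>The first factor on the right is the Jacobian of \<open>angle_sums\<close>. The identity rests on
  \<open>b - a = 2 * sqrt (1 - x\<^sup>2) * sqrt (1 - y\<^sup>2)\<close> for \<open>(a, b) = angle_sums (x, y)\<close>.\<close>

lemma W_square_sector:
  assumes "(x, y) \<in> sector"
  shows "W_square w \<gamma> (x, y) =
    2 * (x\<^sup>2 - y\<^sup>2) / (sqrt (1 - x\<^sup>2) * sqrt (1 - y\<^sup>2)) *
      (b_const w \<gamma> / 4 * angle_weight w \<gamma> (angle_sums (x, y)))"
proof -
  note s = sectorD[OF assms]
  define r where "r = sqrt (1 - x\<^sup>2) * sqrt (1 - y\<^sup>2)"
  have r2: "r\<^sup>2 = (1 - x\<^sup>2) * (1 - y\<^sup>2)" and r0: "r > 0"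
    using s by (simp_all add: r_def power_mult_distrib)
  have x: "-1 \<le> x" "x \<le> 1" "-1 \<le> y" "y \<le> 1" using s by auto
  have c: "cos (arccos x - arccos y) = x * y + r" "cos (arccos x + arccos y) = x * y - r"
    using x by (simp_all add: cos_diff cos_add sin_arccos r_def)
  have "\<bar>(x * y - r) - (x * y + r)\<bar> = 2 * r" using r0 by simp
  moreover have "(2 * r) powr (2 * \<gamma> + 1) = 2 * 4 powr \<gamma> * r * ((1 - x\<^sup>2) powr \<gamma> * (1 - y\<^sup>2) powr \<gamma>)"
  proof -
    have "(2 * r) powr (2 * \<gamma> + 1) = (2 * r) powr (2 * \<gamma>) * (2 * r)"
      using r0 by (simp add: powr_add)
    also have "(2 * r) powr (2 * \<gamma>) = ((2 * r) powr 2) powr \<gamma>" by (simp add: powr_powr)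
    also have "(2 * r) powr 2 = 4 * ((1 - x\<^sup>2) * (1 - y\<^sup>2))"
      using r0 r2 by (simp add: power_mult_distrib)
    also have "\<dots> powr \<gamma> = 4 powr \<gamma> * ((1 - x\<^sup>2) powr \<gamma> * (1 - y\<^sup>2) powr \<gamma>)"
      using s by (simp add: powr_mult)
    finally show ?thesis by simp
  qed
  ultimately have aw: "angle_weight w \<gamma> (angle_sums (x, y)) =
      w (x * y - r) * w (x * y + r) * (2 * 4 powr \<gamma> * r * ((1 - x\<^sup>2) powr \<gamma> * (1 - y\<^sup>2) powr \<gamma>))"
    by (simp add: angle_weight_def angle_sums_def r_def[symmetric])
  show ?thesis
    unfolding aw W_square_def c r_def[symmetric] prod.case using s r0 by (simp add: c)
qed

section \<open>Integrals against the weight on the square\<close>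

text \<open>The bound \<open>\<gamma> \<ge> -1/2\<close> makes the exponent \<open>2 * \<gamma> + 1\<close> nonnegative, hence the power of
  \<open>\<bar>a - b\<bar>\<close> bounded on the square.\<close>

lemma angle_weight_integrable:
  assumes w: "set_integrable lebesgue {-1..1} w" and \<gamma>: "\<gamma> \<ge> -1/2"
    and f: "continuous_on square f"
  shows "set_integrable lebesgue square (\<lambda>z. f z * angle_weight w \<gamma> z)"
proof -
  have S1: "compact square" by (intro compact_Times compact_Icc)
  note S = S1 fmeasurableD[OF lmeasurable_compact[OF S1]]
  have ww: "set_integrable lebesgue square (\<lambda>z. w (fst z) * w (snd z))"
    by (rule set_lebesgue_integral_product(1)[OF w w])
  let ?k = "\<lambda>z. \<bar>fst z - snd z\<bar> powr (2 * \<gamma> + 1)"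
  have "?k \<in> borel_measurable (lebesgue_on square)"
    by (intro measurable_restrict_space1 measurable_completion) (simp add: borel_prod[symmetric])
  moreover have "bounded (?k ` square)"
  proof (rule boundedI)
    fix y assume "y \<in> ?k ` square"
    then obtain a b where ab: "a \<in> {-1..1}" "b \<in> {-1..1}" and y: "y = \<bar>a - b\<bar> powr (2 * \<gamma> + 1)" by auto
    have "\<bar>a - b\<bar> powr (2 * \<gamma> + 1) \<le> 2 powr (2 * \<gamma> + 1)"
      using ab \<gamma> by (intro powr_mono2) auto
    then show "norm y \<le> 2 powr (2 * \<gamma> + 1)" by (simp add: y)
  qed
  ultimately have "set_integrable lebesgue square (\<lambda>z. ?k z * (w (fst z) * w (snd z)))"
    by (intro absolutely_integrable_bounded_measurable_product[OF bilinear_times _ S(2) _ ww])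
  from absolutely_integrable_continuous_mult[OF S(1) f this]
  show ?thesis by (simp add: angle_weight_def case_prod_beta' mult_ac)
qed

lemma angle_sums_has_derivative:
  assumes "(x, y) \<in> sector"
  defines "X \<equiv> sqrt (1 - x\<^sup>2)" and "Y \<equiv> sqrt (1 - y\<^sup>2)"
  shows "(angle_sums has_derivative (\<lambda>(h, k).
      (y * h + x * k + (x * Y / X * h + y * X / Y * k), y * h + x * k - (x * Y / X * h + y * X / Y * k))))
      (at (x, y) within S)"
proof -
  note s = sectorD[OF assms(1)]
  have eq: "angle_sums = (\<lambda>z. (fst z * snd z - sqrt (1 - (fst z)\<^sup>2) * sqrt (1 - (snd z)\<^sup>2),
                             fst z * snd z + sqrt (1 - (fst z)\<^sup>2) * sqrt (1 - (snd z)\<^sup>2)))"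
    by (auto simp: angle_sums_def)
  show ?thesis
    unfolding eq X_def Y_def
    by (rule derivative_eq_intros refl | (use s in \<open>simp; fail\<close>))+
      (use s in \<open>auto simp: fun_eq_iff field_simps\<close>)
qed

lemma sym4_linear: "linear (sym4 e)"
  by (cases e rule: sym4_cases) (auto intro!: linearI)

lemma sector_integral:
  assumes w: "set_integrable lebesgue {-1..1} w" and \<gamma>: "\<gamma> \<ge> -1/2"
    and f: "continuous_on UNIV f"
  defines "h \<equiv> \<lambda>z. f (half_angles z) * (b_const w \<gamma> / 4 * angle_weight w \<gamma> z)"
  shows "set_integrable lebesgue open_triangle h"
    and "set_integrable lebesgue sector (\<lambda>z. f z * W_square w \<gamma> z)"
    and "(LINT z:sector|lebesgue. f z * W_square w \<gamma> z) = (LINT z:open_triangle|lebesgue. h z)"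
proof -
  have sub: "open_triangle \<subseteq> square" by (auto simp: open_triangle_def)
  have "continuous_on square half_angles"
    unfolding half_angles_def case_prod_beta' by (intro continuous_intros) auto
  then have "continuous_on square (\<lambda>z. f (half_angles z) * (b_const w \<gamma> / 4))"
    by (intro continuous_intros continuous_on_compose2[OF f]) auto
  from angle_weight_integrable[OF w \<gamma> this]
  have "set_integrable lebesgue square h" by (simp add: h_def mult.assoc)
  then show i: "set_integrable lebesgue open_triangle h"
    by (rule set_integrable_subset) (auto simp: sub)
  define D where "D = (\<lambda>z. case z of (x, y) \<Rightarrow> (\<lambda>(h, k).
      (y * h + x * k + (x * sqrt (1 - y\<^sup>2) / sqrt (1 - x\<^sup>2) * h + y * sqrt (1 - x\<^sup>2) / sqrt (1 - y\<^sup>2) * k),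
       y * h + x * k - (x * sqrt (1 - y\<^sup>2) / sqrt (1 - x\<^sup>2) * h + y * sqrt (1 - x\<^sup>2) / sqrt (1 - y\<^sup>2) * k))))"
  define J where "J = (\<lambda>(x::real, y::real). 2 * (x\<^sup>2 - y\<^sup>2) / (sqrt (1 - x\<^sup>2) * sqrt (1 - y\<^sup>2)))"
  have der: "(angle_sums has_derivative D z) (at z within sector)" if "z \<in> sector" for z
    using angle_sums_has_derivative[of "fst z" "snd z" sector] that by (cases z) (simp add: D_def)
  have inj: "inj_on angle_sums sector"
    by (rule inj_on_inverseI) (rule half_angles_angle_sums)
  have J: "J z = \<bar>fst (D z (1,0)) * snd (D z (0,1)) - fst (D z (0,1)) * snd (D z (1,0))\<bar>" if "z \<in> sector" for z
  proof (cases z)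
    case (Pair x y)
    note s = sectorD[OF that[unfolded Pair]]
    define X Y where "X = sqrt (1 - x\<^sup>2)" and "Y = sqrt (1 - y\<^sup>2)"
    have XY: "X > 0" "Y > 0" "X\<^sup>2 = 1 - x\<^sup>2" "Y\<^sup>2 = 1 - y\<^sup>2" using s by (simp_all add: X_def Y_def)
    have "fst (D z (1,0)) * snd (D z (0,1)) - fst (D z (0,1)) * snd (D z (1,0))
        = (y + x * Y / X) * (x - y * X / Y) - (x + y * X / Y) * (y - x * Y / X)"
      by (simp add: Pair D_def X_def Y_def)
    also have "\<dots> = 2 * (x\<^sup>2 * Y\<^sup>2 - y\<^sup>2 * X\<^sup>2) / (X * Y)"
      using XY(1,2) by (simp add: field_simps power2_eq_square)
    also have "x\<^sup>2 * Y\<^sup>2 - y\<^sup>2 * X\<^sup>2 = x\<^sup>2 - y\<^sup>2" unfolding XY by (simp add: algebra_simps)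
    finally show ?thesis using XY s by (simp add: Pair J_def X_def[symmetric] Y_def[symmetric])
  qed
  have eq: "f z * W_square w \<gamma> z = J z * h (angle_sums z)" if "z \<in> sector" for z
    using W_square_sector[of "fst z" "snd z" w \<gamma>] that half_angles_angle_sums[OF that]
    by (simp add: J_def h_def case_prod_beta' )
  note CV = change_of_variables_plane[OF sector_lebesgue der inj J, unfolded angle_sums_sector, of h]
  have "set_integrable lebesgue sector (\<lambda>z. f z * W_square w \<gamma> z) \<longleftrightarrow>
      set_integrable lebesgue sector (\<lambda>z. J z * h (angle_sums z))"
    by (intro set_integrable_cong) (auto simp: eq)
  with CV(1) i show "set_integrable lebesgue sector (\<lambda>z. f z * W_square w \<gamma> z)" by simp
  show "(LINT z:sector|lebesgue. f z * W_square w \<gamma> z) = (LINT z:open_triangle|lebesgue. h z)"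
    by (rule trans[OF _ CV(2)[OF _ _ i]], rule set_lebesgue_integral_cong) (auto simp: eq)
qed

text \<open>Cut the square along its diagonals, move the four pieces to the sector by the four symmetries, and
  substitute there. All later statements about the weight on the square go through this formula.\<close>

lemma W_square_integral:
  assumes w: "set_integrable lebesgue {-1..1} w" and \<gamma>: "\<gamma> \<ge> -1/2"
    and f: "continuous_on UNIV f"
  shows "set_integrable lebesgue square (\<lambda>z. f z * W_square w \<gamma> z)"
    and "(LINT z:square|lebesgue. f z * W_square w \<gamma> z) =
      b_const w \<gamma> / 4 * (LINT z:open_triangle|lebesgue.
        four_sum f (fst (half_angles z)) (snd (half_angles z)) * angle_weight w \<gamma> z)"
proof -
  let ?F = "\<lambda>z. f z * W_square w \<gamma> z" and ?A = "\<lambda>e. sym4 e ` sector"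
  let ?h = "\<lambda>e z. f (sym4 e (half_angles z)) * (b_const w \<gamma> / 4 * angle_weight w \<gamma> z)"
  have sub: "sector \<subseteq> square" by (auto simp: sector_def)
  have contf: "continuous_on UNIV (\<lambda>z. f (sym4 e z))" for e
    by (rule continuous_on_compose2[OF f linear_continuous_on])
      (simp_all add: linear_conv_bounded_linear[symmetric] sym4_linear)
  note si = sector_integral[OF w \<gamma> contf]
  have inj4: "e = e' \<and> z = z'" if "z \<in> sector" "z' \<in> sector" "sym4 e z = sym4 e' z'" for e e' z z'
    using sym4_cone_inject[of "snd z" "fst z" "snd z'" "fst z'" e e'] that
    by (simp add: sector_def case_prod_beta' prod_eq_iff)
  have inj: "inj_on (sym4 e) sector" for e
    using inj4 by (intro inj_onI) blast
  have der: "(sym4 e has_derivative sym4 e) (at z within sector)" for e z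
    by (rule linear_imp_has_derivative[OF sym4_linear])
  have J: "1 = \<bar>fst (sym4 e (1,0)) * snd (sym4 e (0,1)) - fst (sym4 e (0,1)) * snd (sym4 e (1,0))\<bar>" for e
    by (cases e rule: sym4_cases) auto
  note CV = change_of_variables_plane[where J="\<lambda>_. 1", OF sector_lebesgue der inj J]
  have eq: "?F (sym4 e z) = f (sym4 e z) * W_square w \<gamma> z" if "z \<in> sector" for e z
    using that sub W_square_sym4[of "fst z" "snd z" w \<gamma> e] by auto
  have iA: "set_integrable lebesgue (?A e) ?F" for e
  proof -
    have "set_integrable lebesgue sector (\<lambda>z. 1 * ?F (sym4 e z)) \<longleftrightarrow>
        set_integrable lebesgue sector (\<lambda>z. f (sym4 e z) * W_square w \<gamma> z)"
      by (intro set_integrable_cong) (auto simp: eq)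
    with si(2)[of e] CV(1)[of ?F e] show ?thesis by simp
  qed
  have IA: "(LINT z:?A e|lebesgue. ?F z) = (LINT z:open_triangle|lebesgue. ?h e z)" for e
  proof -
    have "(LINT z:?A e|lebesgue. ?F z) = (LINT z:sector|lebesgue. 1 * ?F (sym4 e z))"
      by (rule CV(2)[OF iA, symmetric])
    also have "\<dots> = (LINT z:sector|lebesgue. f (sym4 e z) * W_square w \<gamma> z)"
      by (intro set_lebesgue_integral_cong) (auto simp: eq)
    finally show ?thesis by (simp add: si(3))
  qed
  have mA: "?A e \<in> sets lebesgue" for e
  proof -
    have "surj (sym4 e)"
      by (cases e rule: sym4_cases) (auto simp: surj_def, metis minus_minus, metis minus_minus)
    then have "open (?A e)" by (intro open_surjective_linear_image open_sector sym4_linear)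
    then show ?thesis by (simp add: borel_open sets_completionI_sets)
  qed
  have disj: "disjoint_family ?A"
    unfolding disjoint_family_on_def using inj4 by blast
  have iU: "set_integrable lebesgue (\<Union>e. ?A e) ?F"
    by (rule set_integrable_UN) (auto simp: iA mA)
  (* The four images of the sector miss only the two diagonals and the boundary of the square. *)
  let ?N = "{(x,y). 1 * x + 0 * y = -1} \<union> {(x,y). 0 * x + 1 * y = -1} \<union> {(x,y). 1 * x + 0 * y = (1::real)}
    \<union> {(x,y). 0 * x + 1 * y = (1::real)} \<union> {(x,y). 1 * x + (-1) * y = (0::real)} \<union> {(x,y). 1 * x + 1 * y = (0::real)}"
  have "negligible ?N"
    by (intro negligible_Un negligible_line) (auto simp: zero_prod_def)
  moreover have "square - (\<Union>e. ?A e) \<subseteq> ?N"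
  proof
    fix z assume z: "z \<in> square - (\<Union>e. ?A e)"
    obtain x y where xy: "z = (x, y)" by (cases z)
    have "(x, y) \<notin> sector" "(y, x) \<notin> sector" "(-x, -y) \<notin> sector" "(-y, -x) \<notin> sector"
      using z imageI[of "(x,y)" sector "sym4 (False, False)"] imageI[of "(y,x)" sector "sym4 (True, False)"]
        imageI[of "(-x,-y)" sector "sym4 (False, True)"] imageI[of "(-y,-x)" sector "sym4 (True, True)"]
      by (auto simp: xy)
    with z show "z \<in> ?N"
      by (auto simp: xy sector_def)
  qed
  ultimately have N: "negligible (square - (\<Union>e. ?A e))" by (rule negligible_subset)
  have "?A e \<subseteq> square" for e using sub by (cases e rule: sym4_cases) auto
  then have N2: "negligible ((\<Union>e. ?A e) - square)"
    by (auto intro!: negligible_subset[OF negligible_empty])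
  show "set_integrable lebesgue square ?F"
    by (rule set_lebesgue_integral_spike_set(1)[OF iU N2 N])
  have "(LINT z:square|lebesgue. ?F z) = (LINT z:(\<Union>e. ?A e)|lebesgue. ?F z)"
    by (rule set_lebesgue_integral_spike_set(2)[OF iU N2 N, symmetric])
  also have "\<dots> = (\<Sum>e\<in>UNIV. LINT z:?A e|lebesgue. ?F z)"
    by (rule set_integral_finite_Union) (auto simp: iA mA disj)
  also have "\<dots> = (\<Sum>e\<in>UNIV. LINT z:open_triangle|lebesgue. ?h e z)" by (simp add: IA)
  also have "\<dots> = (LINT z:open_triangle|lebesgue. (\<Sum>e\<in>UNIV. ?h e z))"
    using si(1) by (simp add: set_lebesgue_integral_def set_integrable_def sum_distrib_left)
  also have "\<dots> = (LINT z:open_triangle|lebesgue. b_const w \<gamma> / 4 * (four_sum f (fst (half_angles z)) (snd (half_angles z)) * angle_weight w \<gamma> z))"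
    by (simp add: four_sum_sym4 sum_distrib_left sum_distrib_right mult_ac)
  finally show "(LINT z:square|lebesgue. ?F z) =
      b_const w \<gamma> / 4 * (LINT z:open_triangle|lebesgue.
        four_sum f (fst (half_angles z)) (snd (half_angles z)) * angle_weight w \<gamma> z)"
    by simp
qed

section \<open>Lower bounds for the number of nodes\<close>

text \<open>Gaussian elimination: each equation is used to eliminate one unknown.\<close>

lemma underdetermined_linear_system:
  fixes \<phi> :: "'i \<Rightarrow> 'z \<Rightarrow> real"
  assumes "finite Z" "finite I" "card Z < card I"
  shows "\<exists>c. (\<exists>i\<in>I. c i \<noteq> 0) \<and> (\<forall>z\<in>Z. (\<Sum>i\<in>I. c i * \<phi> i z) = 0)"
  using assms
proof (induction Z arbitrary: I \<phi> rule: finite_induct)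
  case empty
  then have "I \<noteq> {}" by auto
  then show ?case by (intro exI[of _ "\<lambda>_. 1"]) auto
next
  case (insert z Z)
  show ?case
  proof (cases "\<forall>i\<in>I. \<phi> i z = 0")
    case True
    have "card Z < card I" using insert.prems insert.hyps by simp
    from insert.IH[OF insert.prems(1) this, of \<phi>] True show ?thesis by auto
  next
    case False
    then obtain i0 where i0: "i0 \<in> I" "\<phi> i0 z \<noteq> 0" by blast
    define \<psi> where "\<psi> = (\<lambda>i y. \<phi> i y - \<phi> i z / \<phi> i0 z * \<phi> i0 y)"
    have "card Z < card (I - {i0})" using insert.prems insert.hyps i0 by simp
    from insert.IH[OF _ this, of \<psi>] insert.prems obtain c where
      c: "\<exists>i\<in>I - {i0}. c i \<noteq> 0" "\<And>y. y \<in> Z \<Longrightarrow> (\<Sum>i\<in>I - {i0}. c i * \<psi> i y) = 0" by auto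
    define t where "t = - (\<Sum>i\<in>I - {i0}. c i * \<phi> i z) / \<phi> i0 z"
    have eq: "(\<Sum>i\<in>I. (c(i0 := t)) i * \<phi> i y) = (\<Sum>i\<in>I - {i0}. c i * \<psi> i y)" for y
    proof -
      have "(\<Sum>i\<in>I. (c(i0 := t)) i * \<phi> i y) = t * \<phi> i0 y + (\<Sum>i\<in>I - {i0}. c i * \<phi> i y)"
        using insert.prems i0 by (subst sum.remove[of _ i0]) auto
      also have "\<dots> = (\<Sum>i\<in>I - {i0}. c i * \<phi> i y) - (\<Sum>i\<in>I - {i0}. c i * \<phi> i z) * (\<phi> i0 y / \<phi> i0 z)"
        by (simp add: t_def)
      also have "\<dots> = (\<Sum>i\<in>I - {i0}. c i * \<phi> i y - c i * \<phi> i z * (\<phi> i0 y / \<phi> i0 z))"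
        by (simp only: sum_subtractf sum_distrib_right)
      also have "\<dots> = (\<Sum>i\<in>I - {i0}. c i * \<psi> i y)"
        by (simp add: \<psi>_def algebra_simps)
      finally show ?thesis .
    qed
    have "\<psi> i z = 0" for i using i0 by (simp add: \<psi>_def)
    with c eq show ?thesis by (intro exI[of _ "c(i0 := t)"]) auto
  qed
qed

definition monomial2 :: "nat \<times> nat \<Rightarrow> real \<times> real \<Rightarrow> real" where
  "monomial2 p z = fst z ^ fst p * snd z ^ snd p"

definition exponents :: "nat \<Rightarrow> (nat \<times> nat) set" where
  "exponents m = {p. fst p + snd p \<le> m}"

lemma exponents_Sigma: "exponents m = Sigma {..m} (\<lambda>i. {..m - i})"
  by (auto simp: exponents_def)

lemma finite_exponents [simp]: "finite (exponents m)"
  by (simp add: exponents_Sigma)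

lemma Pi2_iff: "f \<in> Pi2 m \<longleftrightarrow> (\<exists>c. f = (\<lambda>z. \<Sum>p\<in>exponents m. c p * monomial2 p z))"
proof -
  have eq: "(\<Sum>p\<in>exponents m. c p * monomial2 p (x, y)) = (\<Sum>i\<le>m. \<Sum>j\<le>m - i. c (i, j) * x ^ i * y ^ j)"
    for c x y
    unfolding exponents_Sigma by (subst sum.Sigma) (auto simp: monomial2_def mult.assoc intro!: sum.cong)
  show ?thesis
  proof
    assume "f \<in> Pi2 m"
    then obtain a where a: "\<And>x y. f (x, y) = (\<Sum>i\<le>m. \<Sum>j\<le>m - i. a i j * x ^ i * y ^ j)"
      by (auto simp: Pi2_def)
    have "f = (\<lambda>z. \<Sum>p\<in>exponents m. (\<lambda>(i, j). a i j) p * monomial2 p z)"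
      by (rule ext) (metis (no_types, lifting) a eq prod.collapse case_prod_conv sum.cong)
    then show "\<exists>c. f = (\<lambda>z. \<Sum>p\<in>exponents m. c p * monomial2 p z)" by blast
  next
    assume "\<exists>c. f = (\<lambda>z. \<Sum>p\<in>exponents m. c p * monomial2 p z)"
    then obtain c where "f = (\<lambda>z. \<Sum>p\<in>exponents m. c p * monomial2 p z)" by blast
    then show "f \<in> Pi2 m" by (auto simp: Pi2_def eq intro!: exI[of _ "\<lambda>i j. c (i, j)"])
  qed
qed

lemma Pi2_linear_combination:
  assumes "I \<subseteq> exponents m" shows "(\<lambda>z. \<Sum>p\<in>I. c p * monomial2 p z) \<in> Pi2 m"
proof -
  have "(\<Sum>p\<in>I. c p * monomial2 p z) = (\<Sum>p\<in>exponents m. (if p \<in> I then c p else 0) * monomial2 p z)" for z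
    using assms by (intro sum.mono_neutral_cong_left) auto
  then show ?thesis unfolding Pi2_iff by (intro exI[of _ "\<lambda>p. if p \<in> I then c p else 0"]) simp
qed

lemma Pi2_monomial: "p \<in> exponents m \<Longrightarrow> (\<lambda>z. c * monomial2 p z) \<in> Pi2 m"
  using Pi2_linear_combination[of "{p}" m "\<lambda>_. c"] by simp

lemma Pi2_add: "f \<in> Pi2 m \<Longrightarrow> g \<in> Pi2 m \<Longrightarrow> (\<lambda>z. f z + g z) \<in> Pi2 m"
  unfolding Pi2_iff by (force simp: sum.distrib[symmetric] distrib_right[symmetric])

lemma Pi2_sum: "(\<And>i. i \<in> I \<Longrightarrow> f i \<in> Pi2 m) \<Longrightarrow> (\<lambda>z. \<Sum>i\<in>I. f i z) \<in> Pi2 m"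
proof (induction I rule: infinite_finite_induct)
  case (insert i I)
  then show ?case using Pi2_add[of "f i" m "\<lambda>z. \<Sum>i\<in>I. f i z"] by simp
qed (use Pi2_linear_combination[of "{}" m] in simp_all)

lemma Pi2_mult:
  assumes "f \<in> Pi2 m" "g \<in> Pi2 n" shows "(\<lambda>z. f z * g z) \<in> Pi2 (m + n)"
proof -
  obtain c d where f: "f = (\<lambda>z. \<Sum>p\<in>exponents m. c p * monomial2 p z)"
    and g: "g = (\<lambda>z. \<Sum>p\<in>exponents n. d p * monomial2 p z)"
    using assms by (auto simp: Pi2_iff)
  have "f z * g z = (\<Sum>p\<in>exponents m. \<Sum>q\<in>exponents n. (c p * d q) * monomial2 (fst p + fst q, snd p + snd q) z)" for z
    by (simp add: f g sum_product monomial2_def power_add mult_ac)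
  moreover have "(\<lambda>z. \<Sum>p\<in>exponents m. \<Sum>q\<in>exponents n. (c p * d q) * monomial2 (fst p + fst q, snd p + snd q) z) \<in> Pi2 (m + n)"
    by (intro Pi2_sum Pi2_monomial) (auto simp: exponents_def)
  ultimately show ?thesis by simp
qed

lemma Pi2_mono: "m \<le> n \<Longrightarrow> f \<in> Pi2 m \<Longrightarrow> f \<in> Pi2 n"
proof -
  assume "m \<le> n" "f \<in> Pi2 m"
  moreover then have "exponents m \<subseteq> exponents n" by (auto simp: exponents_def)
  ultimately show ?thesis using Pi2_linear_combination[of "exponents m" n] by (auto simp: Pi2_iff[of _ m])
qed

lemma Pi2_continuous: "f \<in> Pi2 m \<Longrightarrow> continuous_on S f"
proof -
  assume "f \<in> Pi2 m"
  then obtain c where f: "f = (\<lambda>z. \<Sum>p\<in>exponents m. c p * monomial2 p z)" by (auto simp: Pi2_iff)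
  show ?thesis unfolding f monomial2_def by (intro continuous_intros)
qed

text \<open>View the polynomial as a polynomial in \<open>y\<close> with coefficients in \<open>x\<close>. For all but finitely many \<open>x\<close>
  some coefficient is nonzero and the fibre over \<open>x\<close> is finite, so Fubini gives measure zero.\<close>

lemma negligible_polynomial_zeros:
  assumes I: "finite I" and p0: "p0 \<in> I" "c p0 \<noteq> 0"
  shows "negligible {z. (\<Sum>p\<in>I. c p * monomial2 p z) = 0}" (is "negligible ?Z")
proof -
  define Q where "Q = (\<lambda>x. \<Sum>p\<in>I. monom (c p * x ^ fst p) (snd p))"
  define R where "R = (\<Sum>p\<in>{p\<in>I. snd p = snd p0}. monom (c p) (fst p))"
  have Q: "poly (Q x) y = (\<Sum>p\<in>I. c p * monomial2 p (x, y))" for x y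
    by (simp add: Q_def poly_sum poly_monom monomial2_def mult.assoc)
  have "coeff R (fst p0) = (\<Sum>p\<in>{p\<in>I. snd p = snd p0}. if p = p0 then c p else 0)"
    unfolding R_def coeff_sum by (rule sum.cong) (auto simp: prod_eq_iff)
  also have "\<dots> = c p0" using I p0 by (simp add: sum.delta)
  finally have R0: "R \<noteq> 0" using p0 by auto
  have "coeff (Q x) (snd p0) = poly R x" for x
  proof -
    have "coeff (Q x) (snd p0) = (\<Sum>p\<in>I. if snd p = snd p0 then c p * x ^ fst p else 0)"
      by (simp add: Q_def coeff_sum)
    also have "\<dots> = poly R x"
      using I by (simp add: R_def poly_sum poly_monom sum.inter_filter[symmetric])
    finally show ?thesis .
  qed
  then have Q0: "Q x \<noteq> 0" if "poly R x \<noteq> 0" for x using that by (metis coeff_0)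
  have "closed ?Z" unfolding monomial2_def by (intro closed_Collect_eq continuous_intros)
  then have Zb: "?Z \<in> sets (lborel \<Otimes>\<^sub>M lborel)" by (simp only: lborel_prod sets_lborel borel_closed)
  have "emeasure (lborel \<Otimes>\<^sub>M lborel) ?Z = (\<integral>\<^sup>+ x. emeasure lborel (Pair x -` ?Z) \<partial>lborel)"
    by (rule lborel.emeasure_pair_measure_alt[OF Zb])
  also have "\<dots> = (\<integral>\<^sup>+ (x::real). 0 \<partial>lborel)"
  proof (rule nn_integral_cong_AE, rule AE_I')
    show "{x. poly R x = 0} \<in> null_sets lborel"
      using poly_roots_finite[OF R0] by (intro null_setsI) (auto intro: emeasure_lborel_countable countable_finite borel_closed finite_imp_closed)
    have "emeasure lborel (Pair x -` ?Z) = 0" if "poly R x \<noteq> 0" for x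
    proof -
      have "Pair x -` ?Z = {y. poly (Q x) y = 0}" by (auto simp: Q)
      with poly_roots_finite[OF Q0[OF that]] show ?thesis
        by (simp add: emeasure_lborel_countable countable_finite)
    qed
    then show "{x \<in> space lborel. emeasure lborel (Pair x -` ?Z) \<noteq> 0} \<subseteq> {x. poly R x = 0}" by auto
  qed
  finally have "?Z \<in> null_sets lborel"
    using borel_closed[OF \<open>closed ?Z\<close>] by (simp add: null_sets_def lborel_prod)
  then show ?thesis by (simp add: negligible_iff_null_sets null_sets_completionI)
qed

text \<open>With fewer nodes than dimensions, some nonzero polynomial \<open>g\<close> of degree at most \<open>m\<close> vanishes at all
  nodes, and exactness for \<open>g\<^sup>2\<close> contradicts definiteness. This is used to bound the precision of a
  given rule from above.\<close>

lemma cubature_lower_bound_even_degree: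
  assumes Q: "cubature_sum N Q"
    and exact: "\<And>f. f \<in> Pi2 (2 * m) \<Longrightarrow> L f = Q f"
    and definite: "\<And>I c. I \<subseteq> exponents m \<Longrightarrow> L (\<lambda>z. (\<Sum>p\<in>I. c p * monomial2 p z) * (\<Sum>p\<in>I. c p * monomial2 p z)) = 0
      \<Longrightarrow> \<forall>p\<in>I. c p = 0"
  shows "card (exponents m) \<le> N"
proof (rule ccontr)
  assume "\<not> card (exponents m) \<le> N"
  moreover obtain Z \<mu> where Z: "finite Z" "card Z = N" "\<And>f. Q f = (\<Sum>z\<in>Z. \<mu> z * f z)"
    using Q by (auto simp: cubature_sum_def)
  ultimately obtain c where c: "\<exists>p\<in>exponents m. c p \<noteq> 0"
    "\<And>z. z \<in> Z \<Longrightarrow> (\<Sum>p\<in>exponents m. c p * monomial2 p z) = 0"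
    using underdetermined_linear_system[of Z "exponents m" monomial2] by auto
  let ?g = "\<lambda>z. \<Sum>p\<in>exponents m. c p * monomial2 p z"
  have "?g \<in> Pi2 m" by (rule Pi2_linear_combination) simp
  from Pi2_mult[OF this this] have "L (\<lambda>z. ?g z * ?g z) = Q (\<lambda>z. ?g z * ?g z)"
    by (intro exact) (simp add: mult_2)
  also have "\<dots> = 0" using c by (simp add: Z)
  finally have "L (\<lambda>z. ?g z * ?g z) = 0" .
  from definite[OF subset_refl this] c(1) show False by blast
qed

definition odd_exponents :: "nat \<Rightarrow> (nat \<times> nat) set" where
  "odd_exponents k = {p \<in> exponents k. odd (fst p + snd p)}"

text \<open>The lower bound of Moeller for centrally symmetric functionals. Let \<open>G\<close> be the space spanned by the odd monomials of
  degree at most \<open>k\<close> and choose a linear form \<open>l\<close> that vanishes at no node except possibly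
  the origin. If there were fewer than \<open>2 * dim G\<close> nodes, some pair \<open>(g, h) \<noteq> 0\<close> in \<open>G \<times> G\<close> would
  satisfy \<open>g + l * h = 0\<close> at all nodes. The rule sends \<open>g * (g + l * h)\<close> to \<open>0\<close>, and it
  sends the odd polynomial \<open>l * g * h\<close> to \<open>0\<close> as well, being exact for it. Hence \<open>g\<^sup>2\<close> has integral \<open>0\<close> and
  \<open>g = 0\<close>. Then \<open>l * h\<close>, and with it the odd polynomial \<open>h\<close>, vanishes at all nodes, so
  that \<open>h\<^sup>2\<close> has integral \<open>0\<close> and \<open>h = 0\<close>.\<close>

lemma cubature_lower_bound_odd_degree:
  assumes Q: "cubature_sum N Q"
    and exact: "\<And>f. f \<in> Pi2 (2 * k + 1) \<Longrightarrow> L f = Q f"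
    and symmetric: "\<And>f. f \<in> Pi2 (2 * k + 1) \<Longrightarrow> (\<And>z. f (-z) = - f z) \<Longrightarrow> L f = 0"
    and definite: "\<And>I c. I \<subseteq> exponents k \<Longrightarrow> L (\<lambda>z. (\<Sum>p\<in>I. c p * monomial2 p z) * (\<Sum>p\<in>I. c p * monomial2 p z)) = 0
      \<Longrightarrow> \<forall>p\<in>I. c p = 0"
  shows "2 * card (odd_exponents k) \<le> N"
proof (rule ccontr)
  assume less: "\<not> 2 * card (odd_exponents k) \<le> N"
  obtain Z \<mu> where Z: "finite Z" "card Z = N" "\<And>f. Q f = (\<Sum>z\<in>Z. \<mu> z * f z)"
    using Q by (auto simp: cubature_sum_def)
  let ?O = "odd_exponents k"
  have O: "?O \<subseteq> exponents k" "finite ?O"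
    using finite_subset[of ?O "exponents k"] by (auto simp: odd_exponents_def)
  (* Each node other than the origin lies on the kernel of fst + t * snd for at most one t. *)
  have "infinite (UNIV - (\<lambda>z. - fst z / snd z) ` Z)"
    using Z(1) infinite_UNIV_char_0 by (intro Diff_infinite_finite) auto
  then obtain t where t: "t \<notin> (\<lambda>z. - fst z / snd z) ` Z" by (metis Diff_iff ex_in_conv finite.emptyI)
  define l where "l = (\<lambda>z::real\<times>real. fst z + t * snd z)"
  have l: "z = 0" if "z \<in> Z" "l z = 0" for z
  proof (cases "snd z = 0")
    case True
    then show ?thesis using that(2) by (simp add: l_def prod_eq_iff)
  next
    case False
    then have "t = - fst z / snd z" using that(2) by (simp add: l_def field_simps add_eq_0_iff)
    with t that(1) show ?thesis by blast
  qed
  define \<phi> where "\<phi> = (\<lambda>(b, p) z. (if b then l z else 1) * monomial2 p z)"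
  have "card ((UNIV :: bool set) \<times> ?O) = 2 * card ?O" by (simp add: card_cartesian_product)
  with less Z(2) have "card Z < card ((UNIV :: bool set) \<times> ?O)" by simp
  from underdetermined_linear_system[OF Z(1) _ this, of \<phi>] O
  obtain c where c: "\<exists>i\<in>UNIV \<times> ?O. c i \<noteq> 0"
    "\<And>z. z \<in> Z \<Longrightarrow> (\<Sum>i\<in>UNIV \<times> ?O. c i * \<phi> i z) = 0" by auto
  define g where "g = (\<lambda>b z. \<Sum>p\<in>?O. c (b, p) * monomial2 p z)"
  have "(\<Sum>i\<in>UNIV \<times> ?O. c i * \<phi> i z) = g False z + l z * g True z" for z
  proof -
    have "(\<Sum>i\<in>UNIV \<times> ?O. c i * \<phi> i z) = (\<Sum>b\<in>UNIV. \<Sum>p\<in>?O. c (b, p) * \<phi> (b, p) z)"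
      by (simp only: sum.cartesian_product case_prod_beta' prod.collapse)
    then show ?thesis by (simp add: UNIV_bool g_def \<phi>_def sum_distrib_left mult_ac)
  qed
  with c(2) have vanish: "g False z + l z * g True z = 0" if "z \<in> Z" for z using that by simp
  have gPi: "g b \<in> Pi2 k" for b unfolding g_def using O by (intro Pi2_linear_combination)
  have godd: "g b (-z) = - g b z" for b z
    unfolding g_def sum_negf[symmetric]
    by (rule sum.cong) (auto simp: odd_exponents_def monomial2_def power_minus_even power_minus_odd power_minus[of "fst z"] power_minus[of "snd z"])
  have lPi: "l \<in> Pi2 1"
    using Pi2_add[OF Pi2_monomial[of "(1,0)" 1 1] Pi2_monomial[of "(0,1)" 1 t]]
    by (simp add: l_def exponents_def monomial2_def)
  have lodd: "l (-z) = - l z" for z by (simp add: l_def)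
  have g2: "L (\<lambda>z. g b z * g b z) = Q (\<lambda>z. g b z * g b z)" for b
    using Pi2_mult[OF gPi gPi] by (intro exact Pi2_mono[of "k + k" "2 * k + 1"]) auto
  have cross: "(\<lambda>z. l z * (g False z * g True z)) \<in> Pi2 (2 * k + 1)"
    using Pi2_mult[OF lPi Pi2_mult[OF gPi gPi]] by (simp add: mult_2)
  have "Q (\<lambda>z. l z * (g False z * g True z)) = 0"
    using exact[OF cross] symmetric[OF cross] by (simp add: godd lodd)
  moreover have "Q (\<lambda>z. g False z * (g False z + l z * g True z)) = 0"
    by (simp add: Z vanish)
  ultimately have "Q (\<lambda>z. g False z * g False z) = 0"
    by (simp add: Z sum.distrib distrib_left mult_ac)
  with g2 have "L (\<lambda>z. g False z * g False z) = 0" by simp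
  then have c0: "\<forall>p\<in>?O. c (False, p) = 0"
    unfolding g_def by (rule definite[OF O(1), of "\<lambda>p. c (False, p)"])
  have "g True z = 0" if "z \<in> Z" for z
  proof (cases "z = 0")
    case True
    then show ?thesis using godd[of True 0] by simp
  next
    case False
    then have "l z \<noteq> 0" using l that by blast
    moreover have "g False z = 0" using c0 by (simp add: g_def)
    ultimately show ?thesis using vanish[OF that] by simp
  qed
  then have "Q (\<lambda>z. g True z * g True z) = 0" by (simp add: Z)
  with g2 have "L (\<lambda>z. g True z * g True z) = 0" by simp
  then have c1: "\<forall>p\<in>?O. c (True, p) = 0"
    unfolding g_def by (rule definite[OF O(1), of "\<lambda>p. c (True, p)"])
  have "c i = 0" if "i \<in> UNIV \<times> ?O" for i
    using that c0 c1 by (cases i; cases "fst i") auto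
  with c(1) show False by blast
qed

lemma card_antidiagonal: "card {p::nat\<times>nat. fst p + snd p = m} = m + 1"
proof -
  have "bij_betw (\<lambda>i. (i, m - i)) {..m} {p. fst p + snd p = m}"
    by (rule bij_betwI[where g=fst]) auto
  from bij_betw_same_card[OF this] show ?thesis by simp
qed

lemma card_exponents: "2 * card (exponents m) = (m + 1) * (m + 2)"
proof (induction m)
  case 0
  have "exponents 0 = {(0,0)}" by (auto simp: exponents_def)
  then show ?case by simp
next
  case (Suc m)
  have "exponents (Suc m) = exponents m \<union> {p. fst p + snd p = Suc m}" by (auto simp: exponents_def)
  moreover have "card (exponents m \<union> {p. fst p + snd p = Suc m}) = card (exponents m) + (Suc m + 1)"
    unfolding card_antidiagonal[symmetric]
    by (rule card_Un_disjoint) (auto simp: exponents_def intro: finite_subset[OF _ finite_exponents[of "Suc m"]])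
  ultimately show ?case using Suc by simp
qed

lemma card_odd_exponents: "card (odd_exponents (2 * r + 1)) = (r + 1) * (r + 2)"
proof (induction r)
  case 0
  have "s \<le> 2 * 0 + 1 \<and> odd s \<longleftrightarrow> s = 1" for s :: nat by presburger
  then have "odd_exponents (2 * 0 + 1) = {p. fst p + snd p = 1}"
    unfolding odd_exponents_def exponents_def mem_Collect_eq by (simp only:)
  then show ?case using card_antidiagonal[of 1] by simp
next
  case (Suc r)
  have "s \<le> 2 * Suc r + 1 \<and> odd s \<longleftrightarrow> (s \<le> 2 * r + 1 \<and> odd s) \<or> s = 2 * r + 3" for s :: nat
    by presburger
  then have "odd_exponents (2 * Suc r + 1) = odd_exponents (2 * r + 1) \<union> {p. fst p + snd p = 2 * r + 3}"
    unfolding odd_exponents_def exponents_def mem_Collect_eq Un_def by (simp only:)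
  moreover have "card (odd_exponents (2 * r + 1) \<union> {p. fst p + snd p = 2 * r + 3}) =
      card (odd_exponents (2 * r + 1)) + (2 * r + 3 + 1)"
    unfolding card_antidiagonal[of "2 * r + 3", symmetric]
    by (rule card_Un_disjoint)
      (auto simp: odd_exponents_def exponents_def intro: finite_subset[OF _ finite_exponents[of "2 * r + 3"]])
  ultimately show ?case using Suc by simp
qed

section \<open>Symmetric polynomials and product Gaussian quadrature\<close>

text \<open>Polynomials in two variables of degree at most \<open>k\<close> in each of them, generated by
  products. Gaussian quadrature applies to the generators one variable at a time.\<close>

inductive bipoly :: "nat \<Rightarrow> (real \<times> real \<Rightarrow> real) \<Rightarrow> bool" for k where
  product: "degree p \<le> k \<Longrightarrow> degree q \<le> k \<Longrightarrow> bipoly k (\<lambda>z. poly p (fst z) * poly q (snd z))"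
| add: "bipoly k F \<Longrightarrow> bipoly k G \<Longrightarrow> bipoly k (\<lambda>z. F z + G z)"

lemma bipoly_mult:
  assumes "bipoly k F" "bipoly l G" shows "bipoly (k + l) (\<lambda>z. F z * G z)"
  using assms(1)
proof induction
  case (product p q)
  show ?case
    using assms(2)
  proof induction
    case (product p' q')
    have "bipoly (k + l) (\<lambda>z. poly (p * p') (fst z) * poly (q * q') (snd z))"
      using product \<open>degree p \<le> k\<close> \<open>degree q \<le> k\<close>
      by (intro bipoly.product order.trans[OF degree_mult_le] add_mono)
    then show ?case by (simp add: mult_ac)
  next
    case (add F G)
    from bipoly.add[OF add.IH] show ?case by (simp add: distrib_left)
  qed
next
  case (add F F')
  from bipoly.add[OF add.IH] show ?case by (simp add: distrib_right)
qed

lemma bipoly_mono: "bipoly k F \<Longrightarrow> k \<le> l \<Longrightarrow> bipoly l F"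
  by (induction rule: bipoly.induct) (auto intro: bipoly.intros)

lemma bipoly_const: "bipoly k (\<lambda>z. c)"
  using bipoly.product[of "[:c:]" k "[:1:]"] by simp

lemma bipoly_fst: "bipoly 1 fst" and bipoly_snd: "bipoly 1 snd"
  using bipoly.product[of "[:0, 1:]" 1 "[:1:]"] bipoly.product[of "[:1:]" 1 "[:0, 1:]"]
  by (simp_all add: id_def)

lemma bipoly_cmult: "bipoly k F \<Longrightarrow> bipoly k (\<lambda>z. c * F z)"
  using bipoly_mult[OF bipoly_const[of 0 c]] by simp

lemma bipoly_power: "bipoly k F \<Longrightarrow> bipoly (n * k) (\<lambda>z. F z ^ n)"
  by (induction n) (auto intro: bipoly_const bipoly_mult)

lemma bipoly_sum: "(\<And>i. i \<in> I \<Longrightarrow> bipoly k (F i)) \<Longrightarrow> bipoly k (\<lambda>z. \<Sum>i\<in>I. F i z)"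
proof (induction I rule: infinite_finite_induct)
  case (insert i I)
  then show ?case using bipoly.add[of k "F i" "\<lambda>z. \<Sum>i\<in>I. F i z"] by simp
qed (use bipoly_const[of k 0] in simp_all)

lemma bipoly_continuous: "bipoly k F \<Longrightarrow> continuous_on S F"
  by (induction rule: bipoly.induct) (auto intro!: continuous_intros)

text \<open>With \<open>z = (a, b)\<close> and \<open>half_angles z = (x, y)\<close>, this is Newton's recurrence
  \<open>X\<^bsup>d+2\<^esup> + Y\<^bsup>d+2\<^esup> = (X + Y) (X\<^bsup>d+1\<^esup> + Y\<^bsup>d+1\<^esup>) - X Y (X\<^bsup>d\<^esup> + Y\<^bsup>d\<^esup>)\<close> for the squares \<open>X = x\<^sup>2\<close>,
  \<open>Y = y\<^sup>2\<close>, with \<open>X + Y = 1 + a b\<close> of degree one and \<open>X Y = (a + b)\<^sup>2 / 4\<close> of degree two in each of \<open>a\<close>, \<open>b\<close>.\<close>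

lemma even_power_sum_bipoly:
  "\<exists>P. bipoly d P \<and> (\<forall>z\<in>square. fst (half_angles z) ^ (2 * d) + snd (half_angles z) ^ (2 * d) = P z)"
proof (induction d rule: induct_nat_012)
  case 0
  show ?case by (rule exI[of _ "\<lambda>z. 2"]) (simp add: bipoly_const)
next
  case 1
  have "bipoly 1 (\<lambda>z. 1 + fst z * snd z)"
    using bipoly.add[OF bipoly_const bipoly.product[of "[:0, 1:]" 1 "[:0, 1:]"], of 1] by simp
  moreover have "fst (half_angles z) ^ 2 + snd (half_angles z) ^ 2 = 1 + fst z * snd z" if "z \<in> square" for z
    using half_angles_identities(2)[of "fst z" "snd z" "fst (half_angles z)" "snd (half_angles z)"] that by auto
  ultimately show ?case by (auto simp: numeral_2_eq_2)
next
  case (ge2 d)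
  then obtain P0 P1 where P: "bipoly d P0" "bipoly (Suc d) P1"
    and e: "\<And>z. z \<in> square \<Longrightarrow> fst (half_angles z) ^ (2 * d) + snd (half_angles z) ^ (2 * d) = P0 z"
      "\<And>z. z \<in> square \<Longrightarrow> fst (half_angles z) ^ (2 * Suc d) + snd (half_angles z) ^ (2 * Suc d) = P1 z"
    by blast
  let ?P = "\<lambda>z. (1 + fst z * snd z) * P1 z + (- 1 / 4) * ((fst z + snd z) ^ 2 * P0 z)"
  have "bipoly 1 (\<lambda>z. 1 + fst z * snd z)"
    using bipoly.add[OF bipoly_const bipoly.product[of "[:0, 1:]" 1 "[:0, 1:]"], of 1] by simp
  from bipoly_mult[OF this P(2)] have 1: "bipoly (Suc (Suc d)) (\<lambda>z. (1 + fst z * snd z) * P1 z)" by simp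
  have "bipoly 1 (\<lambda>z. fst z + snd z)" by (rule bipoly.add[OF bipoly_fst bipoly_snd])
  from bipoly_mult[OF bipoly_power[OF this, of 2] P(1)]
  have "bipoly (Suc (Suc d)) (\<lambda>z. (fst z + snd z) ^ 2 * P0 z)" by simp
  from bipoly.add[OF 1 bipoly_cmult[OF this]] have "bipoly (Suc (Suc d)) ?P" .
  moreover have "fst (half_angles z) ^ (2 * Suc (Suc d)) + snd (half_angles z) ^ (2 * Suc (Suc d)) = ?P z"
    if z: "z \<in> square" for z
  proof -
    obtain x y where xy: "half_angles z = (x, y)" by (cases "half_angles z")
    have id: "fst z + snd z = 2 * (x * y)" "1 + fst z * snd z = x\<^sup>2 + y\<^sup>2"
      using half_angles_identities[of "fst z" "snd z" x y] xy z by auto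
    have *: "X ^ Suc (Suc d) + Y ^ Suc (Suc d) = (X + Y) * (X ^ Suc d + Y ^ Suc d) - X * Y * (X ^ d + Y ^ d)" for X Y :: real
      by (simp add: algebra_simps)
    have "?P z = (x\<^sup>2 + y\<^sup>2) * ((x\<^sup>2) ^ Suc d + (y\<^sup>2) ^ Suc d) - x\<^sup>2 * y\<^sup>2 * ((x\<^sup>2) ^ d + (y\<^sup>2) ^ d)"
    proof -
      have "(2 * (x * y))\<^sup>2 = 4 * (x\<^sup>2 * y\<^sup>2)" by (simp add: power_mult_distrib)
      moreover have "u + - 1 / 4 * (4 * s * t) = u - s * t" for s t u :: real by simp
      ultimately show ?thesis
        unfolding id e(1)[OF z, symmetric] e(2)[OF z, symmetric] xy fst_conv snd_conv power_mult[of _ 2]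
        by (simp only:)
    qed
    then show ?thesis unfolding xy fst_conv snd_conv power_mult[of _ 2] by (simp only: *)
  qed
  ultimately show ?case by blast
qed

text \<open>The orbit sum of \<open>x\<^bsup>i\<^esup> y\<^bsup>j\<^esup>\<close> vanishes if \<open>i + j\<close> is odd. Otherwise it is
  \<open>2 (x y)\<^bsup>m\<^esup> (x\<^bsup>2d\<^esup> + y\<^bsup>2d\<^esup>)\<close> with \<open>m = min i j\<close> and \<open>i + j = 2 (m + d)\<close>, and \<open>x y = (a + b) / 2\<close>.\<close>

lemma four_sum_monomial_bipoly:
  "\<exists>P. bipoly ((i + j) div 2) P \<and>
    (\<forall>z\<in>square. four_sum (monomial2 (i, j)) (fst (half_angles z)) (snd (half_angles z)) = P z)"
proof (cases "even (i + j)")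
  case False
  then have "four_sum (monomial2 (i, j)) x y = 0" for x y
    by (auto simp: four_sum_def monomial2_def power_minus_even power_minus_odd)
  then show ?thesis by (intro exI[of _ "\<lambda>z. 0"]) (simp add: bipoly_const)
next
  case True
  define m d where "m = min i j" and "d = (max i j - min i j) div 2"
  have md: "max i j = m + 2 * d" "min i j = m" "(i + j) div 2 = m + d"
    using True unfolding m_def d_def by (cases i j rule: le_cases; auto simp: min_def max_def; presburger)+
  obtain P where P: "bipoly d P" "\<And>z. z \<in> square \<Longrightarrow> fst (half_angles z) ^ (2 * d) + snd (half_angles z) ^ (2 * d) = P z"
    using even_power_sum_bipoly[of d] by blast
  let ?P = "\<lambda>z. 2 * ((1/2 * (fst z + snd z)) ^ m * P z)"
  have "bipoly 1 (\<lambda>z. 1/2 * (fst z + snd z))" by (intro bipoly_cmult bipoly.add bipoly_fst bipoly_snd)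
  from bipoly_cmult[OF bipoly_mult[OF bipoly_power[OF this, of m] P(1)], of 2]
  have "bipoly ((i + j) div 2) ?P" by (simp add: md)
  moreover have "four_sum (monomial2 (i, j)) (fst (half_angles z)) (snd (half_angles z)) = ?P z"
    if z: "z \<in> square" for z
  proof -
    obtain x y where xy: "half_angles z = (x, y)" by (cases "half_angles z")
    have id: "1/2 * (fst z + snd z) = x * y"
      using half_angles_identities(1)[of "fst z" "snd z" x y] xy z by auto
    have s: "x ^ i * y ^ j + y ^ i * x ^ j = (x * y) ^ m * (x ^ (2 * d) + y ^ (2 * d))"
      using md by (cases i j rule: le_cases) (simp_all add: max_def min_def power_add algebra_simps split: if_splits)
    have n: "(-s) ^ i * (-t) ^ j = s ^ i * t ^ j" for s t :: real
      using True by (cases "even i") (auto simp: power_minus_even power_minus_odd)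
    have "four_sum (monomial2 (i, j)) x y = 2 * (x ^ i * y ^ j + y ^ i * x ^ j)"
      by (simp add: four_sum_def monomial2_def n)
    then show ?thesis unfolding xy fst_conv snd_conv id s P(2)[OF z, symmetric] .
  qed
  ultimately show ?thesis by blast
qed

text \<open>Halving the degree is what turns the precision \<open>2 * n - 1\<close> of Gaussian quadrature into about twice
  that precision on the square.\<close>

lemma four_sum_bipoly:
  assumes "f \<in> Pi2 m"
  obtains P where "bipoly (m div 2) P"
    "\<And>z. z \<in> square \<Longrightarrow> four_sum f (fst (half_angles z)) (snd (half_angles z)) = P z"
proof -
  obtain c where f: "f = (\<lambda>z. \<Sum>p\<in>exponents m. c p * monomial2 p z)"
    using assms by (auto simp: Pi2_iff)
  have "\<forall>p. \<exists>P. bipoly ((fst p + snd p) div 2) P \<and>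
    (\<forall>z\<in>square. four_sum (monomial2 p) (fst (half_angles z)) (snd (half_angles z)) = P z)"
    using four_sum_monomial_bipoly by auto
  then obtain P where P: "\<And>p. bipoly ((fst p + snd p) div 2) (P p)"
    "\<And>p z. z \<in> square \<Longrightarrow> four_sum (monomial2 p) (fst (half_angles z)) (snd (half_angles z)) = P p z"
    by metis
  show thesis
  proof
    show "bipoly (m div 2) (\<lambda>z. \<Sum>p\<in>exponents m. c p * P p z)"
      by (intro bipoly_sum bipoly_cmult bipoly_mono[OF P(1)] div_le_mono) (simp add: exponents_def)
    have "four_sum f x y = (\<Sum>p\<in>exponents m. c p * four_sum (monomial2 p) x y)" for x y
      by (simp add: f four_sum_def sum.distrib distrib_left)
    then show "four_sum f (fst (half_angles z)) (snd (half_angles z)) = (\<Sum>p\<in>exponents m. c p * P p z)"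
      if "z \<in> square" for z using P(2)[OF that] by simp
  qed
qed

lemma gauss_product_quadrature:
  assumes w: "set_integrable lebesgue {-1..1} w" and g: "gauss_quadrature w n lam \<theta>"
    and F: "bipoly (2 * n - 1) F"
  shows "(c_const w)\<^sup>2 * (LINT z:square|lebesgue. F z * (w (fst z) * w (snd z))) =
    (\<Sum>k=1..n. \<Sum>j=1..n. lam k * lam j * F (cos (\<theta> k), cos (\<theta> j)))"
proof -
  have ip: "set_integrable lebesgue {-1..1} (\<lambda>x. poly p x * w x)" for p
    by (rule absolutely_integrable_continuous_mult[OF _ _ w]) (auto intro!: continuous_intros)
  from F have "set_integrable lebesgue square (\<lambda>z. F z * (w (fst z) * w (snd z))) \<and> ?thesis"
  proof induction
    case (product p q)
    have G: "c_const w * (LINT x:{-1..1}|lebesgue. poly f x * w x) = (\<Sum>k=1..n. lam k * poly f (cos (\<theta> k)))"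
      if "degree f \<le> 2 * n - 1" for f
      using g that by (simp add: gauss_quadrature_def)
    note I = set_lebesgue_integral_product[OF ip[of p] ip[of q]]
    have eq: "(\<lambda>z. poly p (fst z) * poly q (snd z) * (w (fst z) * w (snd z))) =
       (\<lambda>z. (poly p (fst z) * w (fst z)) * (poly q (snd z) * w (snd z)))" by (simp add: mult_ac)
    have "(c_const w)\<^sup>2 * (LINT z:square|lebesgue. (poly p (fst z) * w (fst z)) * (poly q (snd z) * w (snd z))) =
        (c_const w * (LINT x:{-1..1}|lebesgue. poly p x * w x)) * (c_const w * (LINT x:{-1..1}|lebesgue. poly q x * w x))"
      unfolding I(2) by (simp add: power2_eq_square)
    also have "\<dots> = (\<Sum>k=1..n. lam k * poly p (cos (\<theta> k))) * (\<Sum>k=1..n. lam k * poly q (cos (\<theta> k)))"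
      using product by (simp add: G)
    finally show ?case using I(1) unfolding eq by (simp add: sum_product mult_ac)
  next
    case (add F G)
    then show ?case
      by (simp add: distrib_left distrib_right sum.distrib set_integral_add)
  qed
  then show ?thesis ..
qed

section \<open>Cubature rules on the square\<close>

lemma set_integral_nonneg_eq_0_iff:
  fixes F :: "'a::euclidean_space \<Rightarrow> real"
  assumes "set_integrable lebesgue S F" "\<And>z. z \<in> S \<Longrightarrow> 0 \<le> F z"
  shows "(LINT z:S|lebesgue. F z) = 0 \<longleftrightarrow> (AE z in lebesgue. z \<in> S \<longrightarrow> F z = 0)"
proof -
  have "(LINT z:S|lebesgue. F z) = 0 \<longleftrightarrow> (AE z in lebesgue. indicator S z *\<^sub>R F z = 0)"
    unfolding set_lebesgue_integral_def
    using assms by (intro integral_nonneg_eq_0_iff_AE) (auto simp: set_integrable_def indicator_def)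
  also have "\<dots> \<longleftrightarrow> (AE z in lebesgue. z \<in> S \<longrightarrow> F z = 0)"
    by (auto simp: indicator_def intro!: AE_cong)
  finally show ?thesis .
qed

lemma product_weight_triangle_integral:
  fixes w :: "real \<Rightarrow> real"
  assumes w: "set_integrable lebesgue {-1..1} w"
  shows "set_integrable lebesgue open_triangle (\<lambda>z. w (fst z) * w (snd z))"
    and "(LINT z:open_triangle|lebesgue. w (fst z) * w (snd z)) = (LINT x:{-1..1}|lebesgue. w x)\<^sup>2 / 2"
proof -
  note P = set_lebesgue_integral_product[OF w w]
  show "set_integrable lebesgue open_triangle (\<lambda>z. w (fst z) * w (snd z))"
    by (rule set_integrable_subset[OF P(1) open_triangle_lebesgue]) (auto simp: open_triangle_def)
  show "(LINT z:open_triangle|lebesgue. w (fst z) * w (snd z)) = (LINT x:{-1..1}|lebesgue. w x)\<^sup>2 / 2"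
    by (subst triangle_symmetric_integral[OF P(1)]) (simp_all add: P(2) power2_eq_square)
qed

text \<open>Off the diagonal the factor \<open>\<bar>a - b\<bar> powr (2 * \<gamma> + 1)\<close> is positive. If the integral were zero, then
  \<open>w a * w b\<close> would vanish almost everywhere on the triangle, against \<open>(\<integral>w)\<^sup>2 > 0\<close>.\<close>

lemma angle_weight_integral_pos:
  assumes w: "weight_function w" and \<gamma>: "\<gamma> \<ge> -1/2"
  shows "0 < (LINT z:open_triangle|lebesgue. angle_weight w \<gamma> z)"
proof -
  have w0: "set_integrable lebesgue {-1..1} w" and wpos: "0 < (LINT x:{-1..1}|lebesgue. w x)"
    and wn: "\<And>x. x \<in> {-1..1} \<Longrightarrow> 0 \<le> w x"
    using w by (auto simp: weight_function_def)
  have "set_integrable lebesgue square (\<lambda>z. 1 * angle_weight w \<gamma> z)"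
    by (rule angle_weight_integrable[OF w0 \<gamma>]) simp
  then have "set_integrable lebesgue square (angle_weight w \<gamma>)" by simp
  then have i: "set_integrable lebesgue open_triangle (angle_weight w \<gamma>)"
    by (rule set_integrable_subset[OF _ open_triangle_lebesgue]) (auto simp: open_triangle_def)
  have nn: "0 \<le> angle_weight w \<gamma> z" "0 \<le> w (fst z) * w (snd z)" if "z \<in> open_triangle" for z
    using that by (auto simp: open_triangle_def angle_weight_def intro!: mult_nonneg_nonneg wn)
  have "(LINT z:open_triangle|lebesgue. angle_weight w \<gamma> z) \<noteq> 0"
  proof
    assume "(LINT z:open_triangle|lebesgue. angle_weight w \<gamma> z) = 0"
    then have "AE z in lebesgue. z \<in> open_triangle \<longrightarrow> angle_weight w \<gamma> z = 0"
      using set_integral_nonneg_eq_0_iff[OF i nn(1)] by simp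
    then have "AE z in lebesgue. z \<in> open_triangle \<longrightarrow> w (fst z) * w (snd z) = 0"
      by (rule AE_mp) (auto simp: open_triangle_def angle_weight_def intro!: AE_I2)
    then have "(LINT z:open_triangle|lebesgue. w (fst z) * w (snd z)) = 0"
      using set_integral_nonneg_eq_0_iff[OF product_weight_triangle_integral(1)[OF w0] nn(2)] by simp
    with wpos show False by (simp add: product_weight_triangle_integral(2)[OF w0])
  qed
  moreover have "0 \<le> (LINT z:open_triangle|lebesgue. angle_weight w \<gamma> z)"
    unfolding set_lebesgue_integral_def
    by (rule Bochner_Integration.integral_nonneg) (auto simp: indicator_def nn)
  ultimately show ?thesis by simp
qed

lemma b_const_angle_weight: "b_const w \<gamma> = 1 / (LINT z:open_triangle|lebesgue. angle_weight w \<gamma> z)"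
  by (simp add: b_const_def angle_weight_def open_triangle_def case_prod_beta')

lemma W_square_nonneg:
  assumes w: "weight_function w" and \<gamma>: "\<gamma> \<ge> -1/2"
  shows "0 \<le> W_square w \<gamma> z"
proof -
  have "0 \<le> w (cos t)" for t using w by (auto simp: weight_function_def)
  moreover have "0 \<le> b_const w \<gamma>"
    using angle_weight_integral_pos[OF w \<gamma>] by (simp add: b_const_angle_weight)
  ultimately show ?thesis by (simp add: W_square_def case_prod_beta')
qed

lemma W_square_total_mass:
  assumes w: "weight_function w" and \<gamma>: "\<gamma> \<ge> -1/2"
  shows "(LINT z:square|lebesgue. W_square w \<gamma> z) = 1"
proof -
  have w0: "set_integrable lebesgue {-1..1} w" using w by (simp add: weight_function_def)
  have "(LINT z:square|lebesgue. 1 * W_square w \<gamma> z) = 1"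
    unfolding W_square_integral(2)[OF w0 \<gamma> continuous_on_const]
    using angle_weight_integral_pos[OF w \<gamma>] by (simp add: four_sum_def b_const_angle_weight)
  then show ?thesis by simp
qed

text \<open>A nonzero polynomial vanishes only on a null set. If its square had weighted integral zero, the
  weight itself would vanish almost everywhere, although its total mass is 1.\<close>

lemma W_square_definite:
  assumes w: "weight_function w" and \<gamma>: "\<gamma> \<ge> -1/2" and I: "I \<subseteq> exponents m"
    and zero: "(LINT z:square|lebesgue. (\<Sum>p\<in>I. c p * monomial2 p z) * (\<Sum>p\<in>I. c p * monomial2 p z) * W_square w \<gamma> z) = 0"
  shows "\<forall>p\<in>I. c p = 0"
proof (rule ccontr)
  let ?g = "\<lambda>z. \<Sum>p\<in>I. c p * monomial2 p z"
  assume "\<not> (\<forall>p\<in>I. c p = 0)"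
  then obtain p0 where p0: "p0 \<in> I" "c p0 \<noteq> 0" by blast
  have w0: "set_integrable lebesgue {-1..1} w" using w by (simp add: weight_function_def)
  have fin: "finite I" by (rule finite_subset[OF I]) simp
  have "negligible {z. ?g z = 0}" by (rule negligible_polynomial_zeros[where c=c, OF fin p0])
  then have nz: "AE z in lebesgue. ?g z \<noteq> 0"
    unfolding negligible_iff_null_sets by (auto dest: AE_not_in)
  have "continuous_on UNIV ?g" by (rule Pi2_continuous[OF Pi2_linear_combination[OF I]])
  then have "continuous_on UNIV (\<lambda>z. ?g z * ?g z)" by (intro continuous_on_mult)
  note W_square_integral(1)[OF w0 \<gamma> this]
  from set_integral_nonneg_eq_0_iff[OF this] zero
  have "AE z in lebesgue. z \<in> square \<longrightarrow> ?g z * ?g z * W_square w \<gamma> z = 0"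
    by (simp only: mult_nonneg_nonneg W_square_nonneg[OF w \<gamma>] zero_le_square simp_thms)
  with nz have "AE z in lebesgue. z \<in> square \<longrightarrow> W_square w \<gamma> z = 0"
    by eventually_elim auto
  then have "AE z in lebesgue. indicator square z *\<^sub>R W_square w \<gamma> z = 0"
    by eventually_elim (auto simp: indicator_def)
  then have "(LINT z:square|lebesgue. W_square w \<gamma> z) = 0"
    unfolding set_lebesgue_integral_def by (rule integral_eq_zero_AE)
  with W_square_total_mass[OF w \<gamma>] show False by simp
qed

lemma W_square_odd_integral:
  assumes w: "weight_function w" and \<gamma>: "\<gamma> \<ge> -1/2" and f: "continuous_on UNIV f" "\<And>z. f (-z) = - f z"
  shows "(LINT z:square|lebesgue. f z * W_square w \<gamma> z) = 0"
proof -
  have w0: "set_integrable lebesgue {-1..1} w" using w by (simp add: weight_function_def)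
  have "four_sum f s t = 0" for s t
    using f(2)[of "(s, t)"] f(2)[of "(t, s)"] by (simp add: four_sum_def)
  then show ?thesis unfolding W_square_integral(2)[OF w0 \<gamma> f(1)] by simp
qed

text \<open>Minimality follows from exactness and the number of nodes alone. The number
  \<open>2 * (r + 1) * (r + 2)\<close> equals the lower bound for degree \<open>4 * r + 3\<close>, and it is smaller than the number
  \<open>(2 * r + 3) * (r + 2)\<close> of nodes required by degree \<open>4 * r + 4\<close>.\<close>

lemma minimal_cubature_ruleI:
  assumes w: "weight_function w" and \<gamma>: "\<gamma> \<ge> -1/2"
    and Q: "cubature_sum (2 * ((r + 1) * (r + 2))) Q"
    and exact: "cubature_exact (W_square w \<gamma>) square (4 * r + 3) Q"
  shows "minimal_cubature_rule (W_square w \<gamma>) square (4 * r + 3) (2 * ((r + 1) * (r + 2))) Q"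
proof -
  let ?L = "\<lambda>f. LINT z:square|lebesgue. f z * W_square w \<gamma> z"
  note definite = W_square_definite[OF w \<gamma>]
  have "2 * ((r + 1) * (r + 2)) \<le> N'"
    if "cubature_sum N' Q'" "cubature_exact (W_square w \<gamma>) square (4 * r + 3) Q'" for N' Q'
  proof -
    have "2 * card (odd_exponents (2 * r + 1)) \<le> N'"
    proof (rule cubature_lower_bound_odd_degree[OF that(1), of _ ?L])
      have deg: "2 * (2 * r + 1) + 1 = 4 * r + 3" by simp
      show "?L f = Q' f" if "f \<in> Pi2 (2 * (2 * r + 1) + 1)" for f
        using that \<open>cubature_exact (W_square w \<gamma>) square (4 * r + 3) Q'\<close>
        unfolding deg cubature_exact_def by blast
      show "?L f = 0" if "f \<in> Pi2 (2 * (2 * r + 1) + 1)" "\<And>z. f (-z) = - f z" for f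
        using W_square_odd_integral[OF w \<gamma> Pi2_continuous[OF that(1)] that(2)] .
    qed (rule definite)
    then show ?thesis by (simp only: card_odd_exponents)
  qed
  moreover have "\<not> cubature_exact (W_square w \<gamma>) square (4 * r + 3 + 1) Q"
  proof
    have deg: "4 * r + 3 + 1 = 2 * (2 * r + 2)" by simp
    assume "cubature_exact (W_square w \<gamma>) square (4 * r + 3 + 1) Q"
    then have "card (exponents (2 * r + 2)) \<le> 2 * ((r + 1) * (r + 2))"
      unfolding deg cubature_exact_def
      by (intro cubature_lower_bound_even_degree[OF Q, of _ ?L] definite) blast+
    moreover have "2 * card (exponents (2 * r + 2)) = 2 * ((2 * r + 3) * (r + 2))"
      unfolding card_exponents by (simp add: algebra_simps)
    moreover have "(2 * r + 2) * (r + 2) < (2 * r + 3) * (r + 2)"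
      by (rule mult_strict_right_mono) simp_all
    ultimately show False by simp
  qed
  ultimately show ?thesis using Q exact by (auto simp: minimal_cubature_rule_def cubature_rule_def)
qed

text \<open>The nodes of the cubature rule are the images of pairs of Gaussian nodes. By the inequality they lie in the
  open cone \<open>\<bar>y\<bar> < x\<close>, where the four symmetries produce four different points. The node with \<open>s = t\<close>
  lies on the boundary of the square, hence outside \<open>sector\<close>, but still in the cone.\<close>

lemma half_angles_nodes:
  assumes "0 < s" "s < pi" "0 < t" "t < pi"
  shows "half_angles (cos s, cos t) = (cos ((t - s) / 2), cos ((t + s) / 2))"
    and "\<bar>cos ((t + s) / 2)\<bar> < cos ((t - s) / 2)"
proof -
  have pos: "0 < cos (s / 2)" "0 < cos (t / 2)" "0 < sin (s / 2)" "0 < sin (t / 2)"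
    using assms by (auto intro!: cos_gt_zero_pi sin_gt_zero)
  have half: "1 + cos u = 2 * (cos (u / 2))\<^sup>2" "1 - cos u = 2 * (sin (u / 2))\<^sup>2" for u :: real
    using cos_double_cos[of "u / 2"] cos_double_sin[of "u / 2"] by (simp_all add: cos_squared_eq)
  have "(1 + cos s) * (1 + cos t) = (2 * (cos (s / 2) * cos (t / 2)))\<^sup>2"
    "(1 - cos s) * (1 - cos t) = (2 * (sin (s / 2) * sin (t / 2)))\<^sup>2"
    unfolding half by (simp_all add: power_mult_distrib)
  then have "sqrt ((1 + cos s) * (1 + cos t)) = 2 * (cos (s / 2) * cos (t / 2))"
    "sqrt ((1 - cos s) * (1 - cos t)) = 2 * (sin (s / 2) * sin (t / 2))"
    using pos by (simp_all only: real_sqrt_abs abs_of_pos mult_pos_pos zero_less_numeral)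
  then show "half_angles (cos s, cos t) = (cos ((t - s) / 2), cos ((t + s) / 2))"
    by (simp add: half_angles_def diff_divide_distrib add_divide_distrib cos_diff cos_add)
  have "0 < cos (s / 2) * cos (t / 2)" "0 < sin (s / 2) * sin (t / 2)" using pos by simp_all
  then show "\<bar>cos ((t + s) / 2)\<bar> < cos ((t - s) / 2)"
    by (simp add: diff_divide_distrib add_divide_distrib cos_diff cos_add abs_less_iff mult.commute)
qed

lemma cubature_sum_image:
  assumes "finite A" "inj_on h A" "\<And>a. a \<in> A \<Longrightarrow> v a \<noteq> 0"
  shows "cubature_sum (card A) (\<lambda>f. \<Sum>a\<in>A. v a * f (h a))"
  unfolding cubature_sum_def
  using assms
  by (intro exI[of _ "h ` A"] exI[of _ "\<lambda>z. v (the_inv_into A h z)"])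
    (auto simp: card_image sum.reindex the_inv_into_f_f)

text \<open>Counting nodes means showing that the points are distinct. The symmetry is determined by the cone that
  contains the point. Sum and product of \<open>cos (\<theta> k)\<close> and \<open>cos (\<theta> j)\<close> are determined by the point in
  the cone, and so is the pair \<open>j \<le> k\<close>.\<close>

lemma four_sum_cubature_sum:
  assumes g: "gauss_quadrature w n lam \<theta>"
    and A: "A \<subseteq> {(k, j). 1 \<le> j \<and> j \<le> k \<and> k \<le> n}" and v: "\<And>a. a \<in> A \<Longrightarrow> v a \<noteq> 0"
  shows "cubature_sum (4 * card A) (\<lambda>f. \<Sum>(k, j)\<in>A. v (k, j) * four_sum f (node_s \<theta> j k) (node_t \<theta> j k))"
proof -
  let ?h = "\<lambda>(e, (k, j)). sym4 e (node_s \<theta> j k, node_t \<theta> j k)"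
  have fin: "finite A" by (rule finite_subset[OF A], rule finite_subset[of _ "{..n} \<times> {..n}"]) auto
  have \<theta>: "0 < \<theta> k" "\<theta> k < pi" if "k \<in> {1..n}" for k
    using g that by (auto simp: gauss_quadrature_def)
  have injc: "inj_on (\<lambda>k. cos (\<theta> k)) {1..n}"
    using g by (auto simp: gauss_quadrature_def bij_betw_def)
  have kj: "k \<in> {1..n}" "j \<in> {1..n}" "j \<le> k" if "(k, j) \<in> A" for k j using A that by auto
  have node: "half_angles (cos (\<theta> k), cos (\<theta> j)) = (node_s \<theta> j k, node_t \<theta> j k)"
    "\<bar>node_t \<theta> j k\<bar> < node_s \<theta> j k" if "(k, j) \<in> A" for k j
    using half_angles_nodes[OF \<theta>[OF kj(1)[OF that]] \<theta>[OF kj(2)[OF that]]]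
    by (simp_all add: node_s_def node_t_def)
  have "inj_on ?h (UNIV \<times> A)"
  proof (rule inj_onI)
    fix a b assume a: "a \<in> UNIV \<times> A" and b: "b \<in> UNIV \<times> A" and eq: "?h a = ?h b"
    obtain e k j where a': "a = (e, k, j)" "(k, j) \<in> A" using a by (cases a) auto
    obtain e' k' j' where b': "b = (e', k', j')" "(k', j') \<in> A" using b by (cases b) auto
    have *: "e = e'" "node_s \<theta> j k = node_s \<theta> j' k'" "node_t \<theta> j k = node_t \<theta> j' k'"
      using sym4_cone_inject[OF node(2)[OF a'(2)] node(2)[OF b'(2)], of e e'] eq a' b' by auto
    let ?c = "\<lambda>k. cos (\<theta> k)"
    have "?c k + ?c j = ?c k' + ?c j'" "?c k * ?c j = ?c k' * ?c j'"
      using half_angles_identities[OF node(1)[OF a'(2)]] half_angles_identities[OF node(1)[OF b'(2)]] * by auto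
    then have "(?c k - ?c k') * (?c k - ?c j') = 0" "?c k + ?c j = ?c k' + ?c j'" by algebra+
    then have "(?c k = ?c k' \<and> ?c j = ?c j') \<or> (?c k = ?c j' \<and> ?c j = ?c k')" by auto
    then have "(k = k' \<and> j = j') \<or> (k = j' \<and> j = k')"
      using inj_onD[OF injc] kj[OF a'(2)] kj[OF b'(2)] by meson
    with kj[OF a'(2)] kj[OF b'(2)] have "k = k' \<and> j = j'" by auto
    with * show "a = b" by (simp add: a' b')
  qed
  from cubature_sum_image[OF _ this, of "\<lambda>(e, a). v a"]
  have "cubature_sum (card ((UNIV :: (bool \<times> bool) set) \<times> A)) (\<lambda>f. \<Sum>a\<in>UNIV \<times> A. (case a of (e, a) \<Rightarrow> v a) * f (?h a))"
    using fin v by auto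
  moreover have "card ((UNIV :: (bool \<times> bool) set) \<times> A) = 4 * card A"
    by (simp add: card_cartesian_product UNIV_sym4)
  moreover have "(\<Sum>a\<in>UNIV \<times> A. (case a of (e, a) \<Rightarrow> v a) * f (?h a)) =
     (\<Sum>(k, j)\<in>A. v (k, j) * four_sum f (node_s \<theta> j k) (node_t \<theta> j k))" for f
  proof -
    have "(\<Sum>a\<in>UNIV \<times> A. (case a of (e, a) \<Rightarrow> v a) * f (?h a)) = (\<Sum>e\<in>UNIV. \<Sum>a\<in>A. v a * f (?h (e, a)))"
      by (simp only: sum.cartesian_product case_prod_beta' prod.collapse fst_conv snd_conv)
    also have "\<dots> = (\<Sum>a\<in>A. \<Sum>e\<in>UNIV. v a * f (?h (e, a)))" by (rule sum.swap)
    finally show ?thesis by (simp add: four_sum_sym4 sum_distrib_left case_prod_beta')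
  qed
  ultimately show ?thesis by simp
qed

text \<open>Apply the rule to the square of the polynomial that vanishes at all nodes but the \<open>k\<close>-th.\<close>

lemma gauss_weight_pos:
  assumes w: "weight_function w" and n: "n \<ge> 1" and g: "gauss_quadrature w n lam \<theta>" and k: "k \<in> {1..n}"
  shows "0 < lam k"
proof -
  have w0: "set_integrable lebesgue {-1..1} w" and wpos: "0 < (LINT x:{-1..1}|lebesgue. w x)"
    and wn: "\<And>x. x \<in> {-1..1} \<Longrightarrow> 0 \<le> w x"
    using w by (auto simp: weight_function_def)
  have injc: "inj_on (\<lambda>k. cos (\<theta> k)) {1..n}"
    using g by (auto simp: gauss_quadrature_def bij_betw_def)
  define q where "q = (\<Prod>j\<in>{1..n} - {k}. [:- cos (\<theta> j), 1:])"
  have q0: "q \<noteq> 0" by (auto simp: q_def)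
  have "degree q = card ({1..n} - {k})"
    unfolding q_def by (subst degree_prod_eq_sum_degree) auto
  then have dq: "degree (q * q) \<le> 2 * n - 1" using k by (simp add: degree_mult_eq[OF q0 q0])
  have zero: "poly q (cos (\<theta> j)) = 0" if "j \<in> {1..n}" "j \<noteq> k" for j
    unfolding q_def poly_prod using that by (intro prod_zero) auto
  have nonzero: "poly q (cos (\<theta> k)) \<noteq> 0"
    unfolding q_def poly_prod using inj_onD[OF injc] k by (auto simp: algebra_simps)
  have i: "set_integrable lebesgue {-1..1} (\<lambda>x. poly (q * q) x * w x)"
    by (rule absolutely_integrable_continuous_mult[OF _ _ w0]) (auto intro!: continuous_intros)
  have nn: "0 \<le> poly (q * q) x * w x" if "x \<in> {-1..1}" for x using wn[OF that] by simp
  have "(LINT x:{-1..1}|lebesgue. poly (q * q) x * w x) \<noteq> 0"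
  proof
    assume "(LINT x:{-1..1}|lebesgue. poly (q * q) x * w x) = 0"
    then have "AE x in lebesgue. x \<in> {-1..1} \<longrightarrow> poly (q * q) x * w x = 0"
      using set_integral_nonneg_eq_0_iff[OF i nn] by simp
    moreover have "AE x in lebesgue. poly q x \<noteq> 0"
    proof -
      have "negligible {x. poly q x = 0}" using poly_roots_finite[OF q0] by (rule negligible_finite)
      then show ?thesis unfolding negligible_iff_null_sets by (auto dest: AE_not_in)
    qed
    ultimately have "AE x in lebesgue. x \<in> {-1..1} \<longrightarrow> w x = 0" by eventually_elim auto
    then have "(LINT x:{-1..1}|lebesgue. w x) = 0" using set_integral_nonneg_eq_0_iff[OF w0 wn] by simp
    with wpos show False by simp
  qed
  moreover have "0 \<le> (LINT x:{-1..1}|lebesgue. poly (q * q) x * w x)"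
    unfolding set_lebesgue_integral_def
    by (rule Bochner_Integration.integral_nonneg) (use wn in \<open>auto simp: indicator_def\<close>)
  ultimately have "0 < c_const w * (LINT x:{-1..1}|lebesgue. poly (q * q) x * w x)"
    using wpos by (simp add: c_const_def)
  also have "\<dots> = (\<Sum>j=1..n. lam j * poly (q * q) (cos (\<theta> j)))"
    using g dq unfolding gauss_quadrature_def by blast
  also have "\<dots> = lam k * (poly q (cos (\<theta> k)))\<^sup>2"
    using k zero by (subst sum.remove[of _ k]) (auto simp: power2_eq_square)
  finally show ?thesis using nonzero by (simp add: zero_less_mult_iff)
qed

lemma symmetric_sum_triangle:
  fixes G :: "nat \<Rightarrow> nat \<Rightarrow> real"
  assumes "\<And>k j. G k j = G j k"
  shows "(\<Sum>k=1..n. \<Sum>j=1..n. G k j) = 2 * (\<Sum>k=1..n. \<Sum>j=1..k. (if j = k then 1/2 else 1) * G k j)"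
proof (induction n)
  case (Suc n)
  have "(\<Sum>j=1..n. G j (Suc n)) = (\<Sum>j=1..n. G (Suc n) j)"
    by (intro sum.cong refl assms)
  moreover have "(\<Sum>j=1..n. (if j = Suc n then 1/2 else 1) * G (Suc n) j) = (\<Sum>j=1..n. G (Suc n) j)"
    by (rule sum.cong) auto
  ultimately show ?case using Suc by (simp add: sum.distrib)
qed simp

text \<open>The common part of both rules. The polynomial \<open>K\<close> stands for \<open>\<bar>a - b\<bar> powr (2 * \<gamma> + 1)\<close>: it is \<open>1\<close> for
  \<open>\<gamma> = -1/2\<close> and \<open>(a - b)\<^sup>2\<close> for \<open>\<gamma> = 1/2\<close>, and its degree \<open>e\<close> in each variable is
  subtracted from the degree left for the integrand.\<close>

lemma W_square_gauss_cubature: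
  assumes w: "weight_function w" and \<gamma>: "\<gamma> \<ge> -1/2" and g: "gauss_quadrature w n lam \<theta>"
    and K: "bipoly e K" "\<And>a b. K (a, b) = K (b, a)" "\<And>a b. a \<noteq> b \<Longrightarrow> \<bar>a - b\<bar> powr (2 * \<gamma> + 1) = K (a, b)"
    and f: "f \<in> Pi2 m" and m: "m div 2 + e \<le> 2 * n - 1"
  shows "set_integrable lebesgue square (\<lambda>z. f z * W_square w \<gamma> z)"
    and "(LINT z:square|lebesgue. f z * W_square w \<gamma> z) = b_const w \<gamma> / (4 * (c_const w)\<^sup>2) *
     (\<Sum>k=1..n. \<Sum>j=1..k. (if j = k then 1/2 else 1) * (lam k * lam j * K (cos (\<theta> k), cos (\<theta> j)) *
         four_sum f (node_s \<theta> j k) (node_t \<theta> j k)))"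
proof -
  have w0: "set_integrable lebesgue {-1..1} w" and wpos: "0 < (LINT x:{-1..1}|lebesgue. w x)"
    using w by (auto simp: weight_function_def)
  have fc: "continuous_on UNIV f" by (rule Pi2_continuous[OF f])
  show "set_integrable lebesgue square (\<lambda>z. f z * W_square w \<gamma> z)" by (rule W_square_integral(1)[OF w0 \<gamma> fc])
  have c0: "c_const w \<noteq> 0" using wpos by (simp add: c_const_def)
  obtain P where P: "bipoly (m div 2) P"
    "\<And>z. z \<in> square \<Longrightarrow> four_sum f (fst (half_angles z)) (snd (half_angles z)) = P z"
    using four_sum_bipoly[OF f] by blast
  let ?F = "\<lambda>z. P z * K z"
  let ?h = "\<lambda>z. ?F z * (w (fst z) * w (snd z))"
  have F: "bipoly (2 * n - 1) ?F" by (rule bipoly_mono[OF bipoly_mult[OF P(1) K(1)] m])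
  have Psym: "P (b, a) = P (a, b)" if "a \<in> {-1..1}" "b \<in> {-1..1}" for a b
    using P(2)[of "(a, b)"] P(2)[of "(b, a)"] that by (simp add: half_angles_def mult.commute)
  have hi: "set_integrable lebesgue square ?h"
    by (rule absolutely_integrable_continuous_mult[OF _ bipoly_continuous[OF F] set_lebesgue_integral_product(1)[OF w0 w0]])
      (intro compact_Times compact_Icc)
  have "(LINT z:square|lebesgue. f z * W_square w \<gamma> z) = b_const w \<gamma> / 4 * (LINT z:open_triangle|lebesgue. ?h z)"
    unfolding W_square_integral(2)[OF w0 \<gamma> fc]
  proof (intro arg_cong[where f="\<lambda>x. _ * x"] set_lebesgue_integral_cong[OF open_triangle_lebesgue] allI impI)
    fix z assume z: "z \<in> open_triangle"
    then have "\<bar>fst z - snd z\<bar> powr (2 * \<gamma> + 1) = K z" "z \<in> square"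
      using K(3)[of "fst z" "snd z"] by (auto simp: open_triangle_def)
    then show "four_sum f (fst (half_angles z)) (snd (half_angles z)) * angle_weight w \<gamma> z = ?h z"
      by (simp add: P(2) angle_weight_def case_prod_beta')
  qed
  also have "(LINT z:open_triangle|lebesgue. ?h z) = (LINT z:square|lebesgue. ?h z) / 2"
    by (rule triangle_symmetric_integral[OF hi]) (simp add: Psym K(2) mult_ac)
  also have "(LINT z:square|lebesgue. ?h z) =
      (\<Sum>k=1..n. \<Sum>j=1..n. lam k * lam j * ?F (cos (\<theta> k), cos (\<theta> j))) / (c_const w)\<^sup>2"
    using gauss_product_quadrature[OF w0 g F] c0 by (simp add: field_simps)
  also have "(\<Sum>k=1..n. \<Sum>j=1..n. lam k * lam j * ?F (cos (\<theta> k), cos (\<theta> j))) =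
     2 * (\<Sum>k=1..n. \<Sum>j=1..k. (if j = k then 1/2 else 1) * (lam k * lam j * ?F (cos (\<theta> k), cos (\<theta> j))))"
    by (rule symmetric_sum_triangle) (simp add: Psym K(2) mult_ac)
  also have "(\<Sum>k=1..n. \<Sum>j=1..k. (if j = k then 1/2 else 1) * (lam k * lam j * ?F (cos (\<theta> k), cos (\<theta> j)))) =
     (\<Sum>k=1..n. \<Sum>j=1..k. (if j = k then 1/2 else 1) * (lam k * lam j * K (cos (\<theta> k), cos (\<theta> j)) *
         four_sum f (node_s \<theta> j k) (node_t \<theta> j k)))"
  proof (intro sum.cong refl)
    fix k j assume kj: "k \<in> {1..n}" "j \<in> {1..k}"
    then have \<theta>: "0 < \<theta> k" "\<theta> k < pi" "0 < \<theta> j" "\<theta> j < pi"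
      using g by (auto simp: gauss_quadrature_def)
    have "P (cos (\<theta> k), cos (\<theta> j)) = four_sum f (node_s \<theta> j k) (node_t \<theta> j k)"
      using P(2)[of "(cos (\<theta> k), cos (\<theta> j))"] half_angles_nodes(1)[OF \<theta>] by (simp add: node_s_def node_t_def)
    then show "(if j = k then 1/2 else 1) * (lam k * lam j * ?F (cos (\<theta> k), cos (\<theta> j))) =
      (if j = k then 1/2 else 1) * (lam k * lam j * K (cos (\<theta> k), cos (\<theta> j)) * four_sum f (node_s \<theta> j k) (node_t \<theta> j k))"
      by simp
  qed
  finally show "(LINT z:square|lebesgue. f z * W_square w \<gamma> z) = b_const w \<gamma> / (4 * (c_const w)\<^sup>2) *
     (\<Sum>k=1..n. \<Sum>j=1..k. (if j = k then 1/2 else 1) * (lam k * lam j * K (cos (\<theta> k), cos (\<theta> j)) *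
         four_sum f (node_s \<theta> j k) (node_t \<theta> j k)))"
    by simp
qed

text \<open>The triangle carries half the mass of the product weight on the square.\<close>

lemma b_const_minus_half:
  assumes "weight_function w" shows "b_const w (-1/2) = 2 * (c_const w)\<^sup>2"
proof -
  have w0: "set_integrable lebesgue {-1..1} w" using assms by (simp add: weight_function_def)
  have eq: "(LINT z:open_triangle|lebesgue. angle_weight w (-1/2) z) = (LINT z:open_triangle|lebesgue. w (fst z) * w (snd z))"
    by (rule set_lebesgue_integral_cong[OF open_triangle_lebesgue]) (auto simp: angle_weight_def open_triangle_def)
  show ?thesis
    unfolding b_const_angle_weight eq product_weight_triangle_integral(2)[OF w0]
    by (simp add: c_const_def power_divide)
qed

theorem theorem4p2:
  fixes w :: "real \<Rightarrow> real" and n :: nat and lam \<theta> :: "nat \<Rightarrow> real"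
  assumes "weight_function w"
    and "n \<ge> 1"
    and "gauss_quadrature w n lam \<theta>"
  shows
    "minimal_cubature_rule (W_square w (-1/2)) ({-1..1} \<times> {-1..1})
       (4 * n - 1) (dim_Pi2 (2 * n - 1) + n)
       (\<lambda>f. 1/2 * (\<Sum>k=1..n. \<Sum>j=1..k. (if j = k then 1/2 else 1) * (lam k * lam j) *
                      four_sum f (node_s \<theta> j k) (node_t \<theta> j k)))
     \<and>
     (n \<ge> 2 \<longrightarrow>
      minimal_cubature_rule (W_square w (1/2)) ({-1..1} \<times> {-1..1})
       (4 * n - 5) (dim_Pi2 (2 * n - 3) + (n - 1))
       (\<lambda>f. norm_ratio w * (1/2 * (\<Sum>k=2..n. \<Sum>j=1..k-1. lambda2 lam \<theta> j k *
                      four_sum f (node_s \<theta> j k) (node_t \<theta> j k)))))"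
proof (intro conjI impI)
  note w = assms(1) and n = assms(2) and g = assms(3)
  have c0: "c_const w \<noteq> 0" using w by (auto simp: weight_function_def c_const_def)
  have lam: "lam k \<noteq> 0" if "k \<in> {1..n}" for k using gauss_weight_pos[OF w n g that] by simp
  show "minimal_cubature_rule (W_square w (-1/2)) square (4 * n - 1) (dim_Pi2 (2 * n - 1) + n)
     (\<lambda>f. 1/2 * (\<Sum>k=1..n. \<Sum>j=1..k. (if j = k then 1/2 else 1) * (lam k * lam j) *
          four_sum f (node_s \<theta> j k) (node_t \<theta> j k)))" (is "minimal_cubature_rule _ _ _ _ ?Q")
  proof -
    obtain r where r: "n = r + 1" using n by (metis le_add_diff_inverse2)
    let ?A = "SIGMA k:{1..n}. {1..k}"
    let ?v = "\<lambda>(k, j). 1/2 * ((if j = k then 1/2 else 1) * (lam k * lam j))"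
    (* A pair with j = k also contributes four distinct nodes; they lie on the boundary of the square. *)
    have "cubature_sum (4 * card ?A) (\<lambda>f. \<Sum>(k, j)\<in>?A. ?v (k, j) * four_sum f (node_s \<theta> j k) (node_t \<theta> j k))"
      by (rule four_sum_cubature_sum[OF g]) (auto simp: lam split: if_splits)
    moreover have "(\<Sum>(k, j)\<in>?A. ?v (k, j) * four_sum f (node_s \<theta> j k) (node_t \<theta> j k)) = ?Q f" for f
      by (subst sum.Sigma[symmetric]) (auto simp: sum_distrib_left mult_ac intro!: sum.cong)
    moreover have "4 * card ?A = 2 * ((r + 1) * (r + 2))"
    proof -
      have "2 * (\<Sum>k=1..m. k) = m * (m + 1)" for m :: nat by (induction m) auto
      from this[of n] show ?thesis by (simp add: r)
    qed
    ultimately have Q: "cubature_sum (2 * ((r + 1) * (r + 2))) ?Q" by (simp only:)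
    have exact: "cubature_exact (W_square w (-1/2)) square (4 * r + 3) ?Q"
      unfolding cubature_exact_def
    proof (intro ballI conjI)
      fix f assume f: "f \<in> Pi2 (4 * r + 3)"
      have m: "(4 * r + 3) div 2 + 0 \<le> 2 * n - 1" by (simp add: r)
      note * = W_square_gauss_cubature[OF w order_refl g bipoly_const[of 0 1] _ _ f m]
      show "set_integrable lebesgue square (\<lambda>z. f z * W_square w (-1/2) z)" by (rule *(1)) auto
      have "(LINT z:square|lebesgue. f z * W_square w (-1/2) z) = b_const w (-1/2) / (4 * (c_const w)\<^sup>2) *
         (\<Sum>k=1..n. \<Sum>j=1..k. (if j = k then 1/2 else 1) * (lam k * lam j * 1 *
         four_sum f (node_s \<theta> j k) (node_t \<theta> j k)))" by (rule *(2)) auto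
      also have "b_const w (-1/2) / (4 * (c_const w)\<^sup>2) = 1/2"
        unfolding b_const_minus_half[OF w] using c0 by simp
      finally show "(LINT z:square|lebesgue. f z * W_square w (-1/2) z) = ?Q f" by (simp add: mult.assoc)
    qed
    have "dim_Pi2 (2 * n - 1) + n = 2 * ((r + 1) * (r + 2))" "4 * n - 1 = 4 * r + 3"
      by (simp_all add: dim_Pi2_def r algebra_simps)
    with minimal_cubature_ruleI[OF w order_refl Q exact] show ?thesis by simp
  qed
  assume n2: "2 \<le> n"
  show "minimal_cubature_rule (W_square w (1/2)) square (4 * n - 5) (dim_Pi2 (2 * n - 3) + (n - 1))
       (\<lambda>f. norm_ratio w * (1/2 * (\<Sum>k=2..n. \<Sum>j=1..k-1. lambda2 lam \<theta> j k *
                      four_sum f (node_s \<theta> j k) (node_t \<theta> j k))))" (is "minimal_cubature_rule _ _ _ _ ?Q")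
  proof -
    obtain r where r: "n = r + 2" using n2 by (metis le_add_diff_inverse2)
    have \<gamma>: "(1/2::real) \<ge> -1/2" by simp
    have ratio0: "norm_ratio w \<noteq> 0"
      using angle_weight_integral_pos[OF w \<gamma>] angle_weight_integral_pos[OF w order_refl]
      by (simp add: norm_ratio_def b_const_angle_weight)
    have ratio: "b_const w (1/2) / (4 * (c_const w)\<^sup>2) = norm_ratio w * (1/2)"
      using c0 unfolding norm_ratio_def b_const_minus_half[OF w] by simp
    have injc: "inj_on (\<lambda>k. cos (\<theta> k)) {1..n}"
      using g by (auto simp: gauss_quadrature_def bij_betw_def)
    let ?A = "SIGMA k:{2..n}. {1..k-1}"
    let ?v = "\<lambda>(k, j). norm_ratio w * (1/2 * lambda2 lam \<theta> j k)"
    have v: "?v a \<noteq> 0" if a0: "a \<in> ?A" for a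
    proof -
      obtain k j where a: "a = (k, j)" "k \<in> {1..n}" "j \<in> {1..n}" "j \<noteq> k" using a0 by (cases a) auto
      then have "cos (\<theta> j) \<noteq> cos (\<theta> k)" using inj_onD[OF injc] by blast
      with a ratio0 lam show ?thesis by (simp add: lambda2_def)
    qed
    have "cubature_sum (4 * card ?A) (\<lambda>f. \<Sum>(k, j)\<in>?A. ?v (k, j) * four_sum f (node_s \<theta> j k) (node_t \<theta> j k))"
      by (rule four_sum_cubature_sum[OF g _ v]) auto
    moreover have "(\<Sum>(k, j)\<in>?A. ?v (k, j) * four_sum f (node_s \<theta> j k) (node_t \<theta> j k)) = ?Q f" for f
      by (subst sum.Sigma[symmetric]) (auto simp: sum_distrib_left mult_ac intro!: sum.cong)
    moreover have "4 * card ?A = 2 * ((r + 1) * (r + 2))"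
    proof -
      have "2 * (\<Sum>k=2..m + 2. k - 1) = (m + 1) * (m + 2)" for m :: nat by (induction m) auto
      from this[of r] show ?thesis by (simp add: r)
    qed
    ultimately have Q: "cubature_sum (2 * ((r + 1) * (r + 2))) ?Q" by (simp only:)
    let ?K = "\<lambda>z::real\<times>real. (fst z - snd z)\<^sup>2"
    have K: "bipoly 2 ?K"
      using bipoly_power[OF bipoly.add[OF bipoly_fst bipoly_cmult[OF bipoly_snd, of "-1"]], of 2] by simp
    have exact: "cubature_exact (W_square w (1/2)) square (4 * r + 3) ?Q"
      unfolding cubature_exact_def
    proof (intro ballI conjI)
      fix f assume f: "f \<in> Pi2 (4 * r + 3)"
      have m: "(4 * r + 3) div 2 + 2 \<le> 2 * n - 1" by (simp add: r)
      note * = W_square_gauss_cubature[OF w \<gamma> g K _ _ f m]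
      have K2: "\<bar>a - b\<bar> powr (2 * (1/2) + 1) = ?K (a, b)" if "a \<noteq> b" for a b
        using that by simp
      have K1: "?K (a, b) = ?K (b, a)" for a b by (simp add: power2_commute)
      show "set_integrable lebesgue square (\<lambda>z. f z * W_square w (1/2) z)" by (rule *(1)[OF K1 K2])
      let ?G = "\<lambda>k j. lambda2 lam \<theta> j k * four_sum f (node_s \<theta> j k) (node_t \<theta> j k)"
      have "(LINT z:square|lebesgue. f z * W_square w (1/2) z) = norm_ratio w * (1/2) *
         (\<Sum>k=1..n. \<Sum>j=1..k. (if j = k then 1/2 else 1) * (lam k * lam j * ?K (cos (\<theta> k), cos (\<theta> j)) *
         four_sum f (node_s \<theta> j k) (node_t \<theta> j k)))"
        unfolding ratio[symmetric] by (rule *(2)[OF K1 K2])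
      also have "(\<Sum>k=1..n. \<Sum>j=1..k. (if j = k then 1/2 else 1) * (lam k * lam j * ?K (cos (\<theta> k), cos (\<theta> j)) *
         four_sum f (node_s \<theta> j k) (node_t \<theta> j k))) = (\<Sum>k=1..n. \<Sum>j=1..k-1. ?G k j)"
      (* The terms on the diagonal vanish because K does. *)
      proof (rule sum.cong[OF refl])
        fix k assume "k \<in> {1..n}"
        then show "(\<Sum>j=1..k. (if j = k then 1/2 else 1) * (lam k * lam j * ?K (cos (\<theta> k), cos (\<theta> j)) *
         four_sum f (node_s \<theta> j k) (node_t \<theta> j k))) = (\<Sum>j=1..k-1. ?G k j)"
          by (intro sum.mono_neutral_cong_right) (auto simp: lambda2_def power2_commute)
      qed
      (* For k = 1 the inner sum is empty. *)
      also have "\<dots> = (\<Sum>k=2..n. \<Sum>j=1..k-1. ?G k j)"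
        by (rule sum.mono_neutral_right) auto
      finally show "(LINT z:square|lebesgue. f z * W_square w (1/2) z) = ?Q f" by simp
    qed
    have "dim_Pi2 (2 * n - 3) + (n - 1) = 2 * ((r + 1) * (r + 2))" "4 * n - 5 = 4 * r + 3"
      by (simp_all add: dim_Pi2_def r algebra_simps)
    with minimal_cubature_ruleI[OF w \<gamma> Q exact] show ?thesis by simp
  qed
qed

end
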